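(* Let $K\ge3$, and let $1\le q<\frac{2d}{K(d-2)}$ if $d\ge3$, $1\le q<+\infty$ if $d=2$. Then $\bar\beta>0$, where $$\bar\beta:=\inf\left\{\frac{\bar S^{-\frac{Kq}{2}}\Big(\sum_{i=1}^K\|u_i\|_i^2\Big)^{\frac{Kq}{2}}-\sum_{i=1}^K\int_{\mathbb R^d}\mu_i|u_i|^{Kq}}{K\int_{\mathbb R^d}\prod_{i=1}^K|u_i|^q}\ :\ (u_1,\dots,u_K)\in H^1(\mathbb R^d,\mathbb R^K),\ \prod_{i=1}^K u_i\not\equiv0\right\}.$$
   Context: Here $d\ge2$ and $K$ are integers, and $\lambda_i>0$, $\mu_i>0$ ($i=1,\dots,K$) are fixed real numbers. Notation: $\|u\|_i^2:=\int_{\mathbb R^d}(|\nabla u|^2+\lambda_iu^2)$, $$c_{p,\lambda,\mu}:=\inf_{u\in H^1(\mathbb R^d)\setminus\{0\}}\frac{\int_{\mathbb R^d}|\nabla u|^2+\lambda u^2}{\left(\int_{\mathbb R^d}\mu|u|^p\right)^{2/p}},\qquad \bar S:=\min_{i=1,\dots,K}c_{Kq,\lambda_i,\mu_i}.$$ *)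

theory Defs
  imports "HOL-Analysis.Analysis"
begin

text \<open>The library has no \<open>C\<^sup>k\<close> functions of several variables.\<close>

fun Ck :: "nat \<Rightarrow> ('a::euclidean_space \<Rightarrow> real) \<Rightarrow> bool" where
  "Ck 0 f \<longleftrightarrow> continuous_on UNIV f"
| "Ck (Suc k) f \<longleftrightarrow> (\<forall>x. f differentiable (at x)) \<and>
     (\<forall>b\<in>Basis. Ck k (\<lambda>x. frechet_derivative f (at x) b))"

definition test_function :: "('a::euclidean_space \<Rightarrow> real) \<Rightarrow> bool" where
  "test_function \<phi> \<longleftrightarrow> (\<forall>k. Ck k \<phi>) \<and> compact (closure {x. \<phi> x \<noteq> 0})"

definition square_integrable ::
  "('a::euclidean_space \<Rightarrow> 'b::euclidean_space) \<Rightarrow> bool" where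
  "square_integrable f \<longleftrightarrow>
     f \<in> borel_measurable lborel \<and> integrable lborel (\<lambda>x. (norm (f x))\<^sup>2)"

definition has_weak_gradient ::
  "('a::euclidean_space \<Rightarrow> real) \<Rightarrow> ('a \<Rightarrow> 'a) \<Rightarrow> bool" where
  "has_weak_gradient u g \<longleftrightarrow> (\<forall>\<phi>. test_function \<phi> \<longrightarrow> (\<forall>b\<in>Basis.
     (\<integral>x. u x * frechet_derivative \<phi> (at x) b \<partial>lborel) =
     - (\<integral>x. (g x \<bullet> b) * \<phi> x \<partial>lborel)))"

text \<open>Elements of \<open>H\<^sup>1\<close> are represented by Borel functions. Functions that agree almost
  everywhere are not identified, so ``nonzero'' always means ``not almost everywhere zero''.\<close>

definition H1 :: "('a::euclidean_space \<Rightarrow> real) set" where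
  "H1 = {u. square_integrable u \<and> (\<exists>g. square_integrable g \<and> has_weak_gradient u g)}"

text \<open>The weak gradient is determined only up to a null set; the integrals below do not
  depend on the choice.\<close>

definition weak_gradient :: "('a::euclidean_space \<Rightarrow> real) \<Rightarrow> 'a \<Rightarrow> 'a" where
  "weak_gradient u = (SOME g. square_integrable g \<and> has_weak_gradient u g)"

definition energy :: "real \<Rightarrow> ('a::euclidean_space \<Rightarrow> real) \<Rightarrow> real" where
  "energy \<Lambda> u = (\<integral>x. (norm (weak_gradient u x))\<^sup>2 + \<Lambda> * (u x)\<^sup>2 \<partial>lborel)"

text \<open>The \<open>itself\<close> argument names the domain, since \<open>u\<close> is bound inside the infimum.\<close>

definition sobolev_const :: "'a::euclidean_space itself \<Rightarrow> real \<Rightarrow> real \<Rightarrow> real \<Rightarrow> real" where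
  "sobolev_const _ p \<Lambda> m =
     (INF u \<in> {u :: 'a \<Rightarrow> real. u \<in> H1 \<and> \<not> (AE x in lborel. u x = 0)}.
        energy \<Lambda> u / (\<integral>x. m * \<bar>u x\<bar> powr p \<partial>lborel) powr (2 / p))"

definition S_bar ::
  "'a::euclidean_space itself \<Rightarrow> nat \<Rightarrow> real \<Rightarrow> (nat \<Rightarrow> real) \<Rightarrow> (nat \<Rightarrow> real) \<Rightarrow> real" where
  "S_bar T K q \<Lambda> \<mu> = Min ((\<lambda>i. sobolev_const T (real K * q) (\<Lambda> i) (\<mu> i)) ` {1..K})"

definition beta_bar ::
  "'a::euclidean_space itself \<Rightarrow> nat \<Rightarrow> real \<Rightarrow> (nat \<Rightarrow> real) \<Rightarrow> (nat \<Rightarrow> real) \<Rightarrow> real" where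
  "beta_bar T K q \<Lambda> \<mu> =
     (INF u \<in> {u :: nat \<Rightarrow> 'a \<Rightarrow> real. (\<forall>i\<in>{1..K}. u i \<in> H1) \<and>
                 \<not> (AE x in lborel. (\<Prod>i=1..K. u i x) = 0)}.
        (S_bar T K q \<Lambda> \<mu> powr (- (real K * q / 2)) *
           (\<Sum>i=1..K. energy (\<Lambda> i) (u i)) powr (real K * q / 2)
         - (\<Sum>i=1..K. \<integral>x. \<mu> i * \<bar>u i x\<bar> powr (real K * q) \<partial>lborel))
        / (real K * (\<integral>x. (\<Prod>i=1..K. \<bar>u i x\<bar> powr q) \<partial>lborel)))"

end

theory Submission
  imports Defs
begin

text \<open>
  Put \<open>p = K q\<close> and \<open>a\<^sub>i = \<parallel>u\<^sub>i\<parallel>\<^sub>i\<^sup>2\<close>. If \<open>S > 0\<close>, then \<open>\<integral> \<mu>\<^sub>i |u\<^sub>i|\<^sup>p\<close> is at most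
  \<open>S powr (- p / 2) * a\<^sub>i powr (p / 2)\<close>, so the numerator dominates
  \<open>(\<Sum> a\<^sub>i) powr (p / 2) - \<Sum> a\<^sub>i powr (p / 2)\<close>, while by Hoelder the denominator is at most a constant
  times \<open>\<Prod> a\<^sub>i powr (q / 2)\<close>; for \<open>K \<ge> 3\<close> the former controls the latter.

  The positivity of \<open>S\<close> is the subcritical Sobolev embedding. Testing the weak gradient against
  translates of test functions gives \<open>\<parallel>u(\<cdot> + y) - u\<parallel>\<^sub>2 \<le> |y| \<parallel>\<nabla>u\<parallel>\<^sub>2\<close> by duality. Averaging over a cube of
  \<open>y\<close> whose volume is twice that of \<open>{|u| > l}\<close> yields
  \<open>|{|u| > 2 l}| \<le> C l\<^sup>-\<^sup>2 |{|u| > l}| powr (2 / d) \<parallel>\<nabla>u\<parallel>\<^sub>2\<^sup>2\<close>, and iterating over \<open>l = 2 ^ k\<close> gives the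
  decay of the superlevel sets that makes \<open>|u|\<^sup>p\<close> integrable.
\<close>

subsection \<open>Smooth cutoff functions\<close>

text \<open>The factor \<open>S powr (- p / 2)\<close> is the constant of the one-component
  embedding, so componentwise estimates alone give only a nonnegative numerator: positivity has to
  come from the mixed terms of \<open>(\<Sum> a_i) powr (p / 2)\<close>. Numerator and denominator
  are both compared with \<open>\<Prod> a_i powr (q / 2)\<close>, which has degree
  \<open>p / 2\<close> in the \<open>a_i\<close>, as the numerator does; hence the bound on the
  quotient is free of \<open>u\<close>.

  The analytic obstacle is that an element of \<open>H1\<close> is known only through pairings with
  test functions. No smooth approximation of \<open>u\<close> is made: derivatives always fall on
  the test function, and all that is kept of the gradient is the translation estimate. The recursion
  for the superlevel sets has the fixed exponent \<open>s = 2 + 2 * s / d\<close>, that is the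
  critical \<open>2 * d / (d - 2)\<close>; below it every step gains, and for \<open>d = 2\<close>
  there is no such exponent.

  The infima are taken in the reals, so each lower bound also requires an explicit member of the
  index set. The smooth cutoffs supply it, besides serving as test functions.\<close>

definition flat_exp :: "nat \<Rightarrow> real \<Rightarrow> real" where
  "flat_exp m t = (if t > 0 then exp (- 1 / t) / t ^ m else 0)"

lemma flat_exp_tendsto_0: "(flat_exp m \<longlongrightarrow> 0) (at 0)"
proof -
  have "((\<lambda>t. inverse t ^ m / exp (inverse t)) \<longlongrightarrow> (0::real)) (at_right 0)"
    by (rule filterlim_compose[OF tendsto_power_div_exp_0 filterlim_inverse_at_top_right])
  then have "(flat_exp m \<longlongrightarrow> 0) (at_right 0)"
  proof (rule Lim_transform_eventually)
    show "\<forall>\<^sub>F t in at_right 0. inverse t ^ m / exp (inverse t) = flat_exp m t"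
      using eventually_at_right_less[of "0::real"]
      by eventually_elim (simp add: flat_exp_def exp_minus field_simps)
  qed
  moreover have "(flat_exp m \<longlongrightarrow> 0) (at_left 0)"
  proof (rule Lim_transform_eventually[OF tendsto_const])
    show "\<forall>\<^sub>F t in at_left 0. 0 = flat_exp m t"
      by (auto simp: flat_exp_def eventually_at intro!: exI[of _ 1])
  qed
  ultimately show ?thesis
    by (simp add: filterlim_at_split)
qed

text \<open>The index \<open>m\<close> makes the family closed under differentiation up to linear
  combinations, so smoothness becomes an induction on the order. At \<open>0\<close> the difference
  quotient of \<open>flat_exp m\<close> is \<open>flat_exp (Suc m)\<close>, whose limit
  \<open>0\<close> is the derivative there.\<close>

lemma flat_exp_has_derivative:
  "(flat_exp m has_real_derivative flat_exp (m + 2) t - real m * flat_exp (m + 1) t) (at t)"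
proof -
  consider "t > 0" | "t < 0" | "t = 0" by linarith
  then show ?thesis
  proof cases
    case 1
    \<comment> \<open>The truncated exponent \<open>m - 1\<close> is harmless at
      \<open>m = 0\<close>, because the factor \<open>real m\<close> vanishes.\<close>
    have "real m * inverse t ^ (m - 1) * inverse t ^ 2 = real m * inverse t ^ (m + 1)"
      by (cases m) (auto simp: power2_eq_square)
    moreover have "((\<lambda>t. exp (- 1 / t) * inverse t ^ m) has_real_derivative
        exp (- 1 / t) * inverse t ^ 2 * inverse t ^ m
        - exp (- 1 / t) * (real m * inverse t ^ (m - 1) * inverse t ^ 2)) (at t)"
    proof -
      have i: "(inverse has_real_derivative - (inverse t ^ 2)) (at t)"
        using 1 by (auto intro!: derivative_eq_intros simp: field_simps power2_eq_square)
      have "((\<lambda>t. exp (- 1 / t)) has_real_derivative exp (- 1 / t) * inverse t ^ 2) (at t)"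
        using 1 by (auto intro!: derivative_eq_intros simp: field_simps power2_eq_square)
      from DERIV_mult[OF this DERIV_power[OF i, of m]] show ?thesis
        by (simp add: algebra_simps)
    qed
    ultimately have "((\<lambda>t. exp (- 1 / t) * inverse t ^ m) has_real_derivative
        exp (- 1 / t) * inverse t ^ 2 * inverse t ^ m - exp (- 1 / t) * (real m * inverse t ^ (m + 1))) (at t)"
      by (simp only:)
    then have "((\<lambda>t. exp (- 1 / t) * inverse t ^ m) has_real_derivative
        flat_exp (m + 2) t - real m * flat_exp (m + 1) t) (at t)"
      using 1 by (simp add: flat_exp_def field_simps power2_eq_square)
    then show ?thesis
      by (rule has_field_derivative_transform_within_open[of _ _ _ "{0<..}"])
        (use 1 in \<open>auto simp: flat_exp_def field_simps\<close>)
  next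
    case 2
    have "((\<lambda>t. 0) has_real_derivative 0) (at t)" by simp
    then have "(flat_exp m has_real_derivative 0) (at t)"
      by (rule has_field_derivative_transform_within_open[of _ _ _ "{..<0}"])
        (use 2 in \<open>auto simp: flat_exp_def\<close>)
    with 2 show ?thesis by (simp add: flat_exp_def)
  next
    case 3
    have "((\<lambda>h. (flat_exp m (0 + h) - flat_exp m 0) / h) \<longlongrightarrow> 0) (at 0)"
      by (rule Lim_transform_eventually[OF flat_exp_tendsto_0[of "Suc m"]])
        (auto simp: eventually_at flat_exp_def intro!: exI[of _ 1])
    with 3 show ?thesis by (simp add: DERIV_def flat_exp_def)
  qed
qed

lemma flat_exp_0_bounds: "0 \<le> flat_exp 0 t" "flat_exp 0 t \<le> 1"
  by (auto simp: flat_exp_def)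

text \<open>Polynomiality of the derivative in each fixed direction keeps the product and chain
  rules inside sums of polynomials times \<open>flat_exp\<close> of a polynomial.\<close>

lemma real_polynomial_function_has_derivative:
  fixes P :: "'a::real_normed_vector \<Rightarrow> real"
  assumes "real_polynomial_function P"
  shows "\<exists>P'. (\<forall>x. (P has_derivative P' x) (at x)) \<and> (\<forall>b. real_polynomial_function (\<lambda>x. P' x b))"
  using assms
proof induction
  case (linear f)
  then show ?case
    by (intro exI[of _ "\<lambda>x. f"]) (auto intro: bounded_linear_imp_has_derivative real_polynomial_function.intros)
next
  case (const c)
  show ?case
    by (intro exI[of _ "\<lambda>x h. 0"]) (auto intro: real_polynomial_function.intros)
next
  case (add f g)
  then obtain f' g' where "\<forall>x. (f has_derivative f' x) (at x)" "\<forall>b. real_polynomial_function (\<lambda>x. f' x b)"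
    "\<forall>x. (g has_derivative g' x) (at x)" "\<forall>b. real_polynomial_function (\<lambda>x. g' x b)" by blast
  then show ?case
    by (intro exI[of _ "\<lambda>x h. f' x h + g' x h"])
      (auto intro: has_derivative_add real_polynomial_function.intros)
next
  case (mult f g)
  then obtain f' g' where "\<forall>x. (f has_derivative f' x) (at x)" "\<forall>b. real_polynomial_function (\<lambda>x. f' x b)"
    "\<forall>x. (g has_derivative g' x) (at x)" "\<forall>b. real_polynomial_function (\<lambda>x. g' x b)" by blast
  with mult.hyps show ?case
    by (intro exI[of _ "\<lambda>x h. f x * g' x h + f' x h * g x"])
      (intro conjI allI has_derivative_mult real_polynomial_function.intros(3,4); simp)
qed

lemma frechet_derivative_eqI: "(f has_derivative f') (at x) \<Longrightarrow> frechet_derivative f (at x) = f'"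
  using frechet_derivative_at by metis

lemma Ck_add: "Ck k f \<Longrightarrow> Ck k g \<Longrightarrow> Ck k (\<lambda>x. f x + g x)"
proof (induction k arbitrary: f g)
  case 0
  then show ?case by (auto intro: continuous_on_add)
next
  case (Suc k)
  have "frechet_derivative (\<lambda>x. f x + g x) (at x) b =
      frechet_derivative f (at x) b + frechet_derivative g (at x) b" for x b
    using Suc.prems
    by (subst frechet_derivative_eqI[OF has_derivative_add]) (auto simp: frechet_derivative_works[symmetric])
  with Suc show ?case by auto
qed

lemma Ck_translate:
  fixes f :: "'a::euclidean_space \<Rightarrow> real"
  shows "Ck k f \<Longrightarrow> Ck k (\<lambda>x. f (x + h))"
proof (induction k arbitrary: f)
  case 0
  then show ?case by (auto intro!: continuous_on_compose2[of UNIV f] continuous_intros)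
next
  case (Suc k)
  have der: "((\<lambda>x. f (x + h)) has_derivative frechet_derivative f (at (x + h))) (at x)" for x
    apply (rule has_derivative_compose[of "\<lambda>x. x + h" "\<lambda>x. x" x UNIV f])
    using Suc.prems by (auto simp: frechet_derivative_works[symmetric] intro!: derivative_eq_intros)
  show ?case
    using der Suc by (auto simp: frechet_derivative_eqI[OF der] differentiable_def)
qed

text \<open>Generality in \<open>P\<close> and \<open>m\<close> carries the induction: the
  derivative of one such product is a sum of three of the same form, with indices \<open>m\<close>,
  \<open>m + 1\<close> and \<open>m + 2\<close>.\<close>

lemma Ck_polynomial_flat_exp:
  fixes P r :: "'a::euclidean_space \<Rightarrow> real"
  assumes "real_polynomial_function r" "real_polynomial_function P"
  shows "Ck k (\<lambda>x. P x * flat_exp m (r x))"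
  using assms(2)
proof (induction k arbitrary: P m)
  case 0
  have "continuous_on UNIV (flat_exp m)"
    using flat_exp_has_derivative by (metis DERIV_isCont continuous_at_imp_continuous_on)
  moreover have "continuous_on UNIV P" "continuous_on UNIV r"
    using 0 assms by (auto intro: continuous_at_imp_continuous_on continuous_real_polymonial_function)
  ultimately show ?case
    by (auto intro!: continuous_on_mult continuous_on_compose2[of UNIV "flat_exp m" UNIV r])
next
  case (Suc k)
  obtain P' r' where
    P': "\<And>x. (P has_derivative P' x) (at x)" "\<And>b. real_polynomial_function (\<lambda>x. P' x b)" and
    r': "\<And>x. (r has_derivative r' x) (at x)" "\<And>b. real_polynomial_function (\<lambda>x. r' x b)"
    using real_polynomial_function_has_derivative[OF assms(1)]
      real_polynomial_function_has_derivative[OF Suc.prems] by metis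
  define D where "D x b = (P' x b * flat_exp m (r x) + (P x * r' x b) * flat_exp (m + 2) (r x))
      + (- real m * (P x * r' x b)) * flat_exp (m + 1) (r x)" for x b
  have der: "((\<lambda>x. P x * flat_exp m (r x)) has_derivative D x) (at x)" for x
    apply (rule has_derivative_eq_rhs)
     apply (rule has_derivative_mult[OF P'(1)])
     apply (rule has_derivative_compose[OF r'(1)])
     apply (rule flat_exp_has_derivative[unfolded has_field_derivative_def])
    apply (auto simp: D_def fun_eq_iff algebra_simps)
    done
  have "Ck k (\<lambda>x. D x b)" for b
    unfolding D_def
    by (intro Ck_add Suc.IH real_polynomial_function.intros P' r' Suc.prems)
  with der show ?case
    by (auto simp: frechet_derivative_eqI[OF der] differentiable_def)
qed

lemma test_function_translate:
  fixes \<phi> :: "'a::euclidean_space \<Rightarrow> real"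
  assumes "test_function \<phi>"
  shows "test_function (\<lambda>x. \<phi> (x + h))"
proof -
  have "{x. \<phi> (x + h) \<noteq> 0} = (\<lambda>x. - h + x) ` {x. \<phi> x \<noteq> 0}"
    by (auto simp: image_iff) (metis add.commute add_diff_cancel uminus_add_conv_diff)
  then show ?thesis
    using assms by (auto simp: test_function_def Ck_translate bounded_translation_minus)
qed

lemma real_polynomial_function_norm2:
  "real_polynomial_function (\<lambda>x::'a::euclidean_space. (norm x)\<^sup>2)"
  unfolding power2_norm_eq_inner
  by (subst euclidean_inner) (intro real_polynomial_function_sum finite_Basis real_polynomial_function.intros bounded_linear_inner_left)

text \<open>\<open>P\<close> and \<open>c\<close> are left free for a later approximation:
  \<open>P\<close> runs through approximating polynomials, and as \<open>c\<close> grows the cutoff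
  tends to \<open>1\<close> inside the ball while its support stays within radius
  \<open>\<bar>R\<bar>\<close>.\<close>

lemma test_function_polynomial_cutoff:
  fixes P :: "'a::euclidean_space \<Rightarrow> real"
  assumes "real_polynomial_function P" "c > 0"
  shows "test_function (\<lambda>x. P x * flat_exp 0 (c * (R\<^sup>2 - (norm x)\<^sup>2)))"
  unfolding test_function_def
proof (intro conjI allI)
  have "real_polynomial_function (\<lambda>x::'a. c * (R\<^sup>2 - (norm x)\<^sup>2))"
    by (intro real_polynomial_function_diff real_polynomial_function_norm2 real_polynomial_function.intros)
  then show "Ck k (\<lambda>x. P x * flat_exp 0 (c * (R\<^sup>2 - (norm x)\<^sup>2)))" for k
    by (rule Ck_polynomial_flat_exp) (rule assms)
  have "{x. P x * flat_exp 0 (c * (R\<^sup>2 - (norm x)\<^sup>2)) \<noteq> 0} \<subseteq> cball 0 \<bar>R\<bar>"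
    using assms(2)
    by (auto simp: flat_exp_def zero_less_mult_iff split: if_splits) (metis abs_le_square_iff abs_norm_cancel less_imp_le)
  then have "bounded {x. P x * flat_exp 0 (c * (R\<^sup>2 - (norm x)\<^sup>2)) \<noteq> 0}"
    using bounded_cball bounded_subset by blast
  then show "compact (closure {x. P x * flat_exp 0 (c * (R\<^sup>2 - (norm x)\<^sup>2)) \<noteq> 0})"
    by (simp add: compact_closure)
qed

subsection \<open>Differentiation under translations\<close>

lemma integral_lborel_translate:
  fixes f :: "'a::euclidean_space \<Rightarrow> real"
  assumes "f \<in> borel_measurable borel"
  shows "(\<integral>x. f (x + h) \<partial>lborel) = (\<integral>x. f x \<partial>lborel)"
proof -
  have "(\<integral>x. f x \<partial>lborel) = (\<integral>x. f x \<partial>distr lborel borel ((+) h))"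
    by (simp only: lborel_distr_plus)
  also have "\<dots> = (\<integral>x. f (h + x) \<partial>lborel)"
    using assms by (intro integral_distr) auto
  finally show ?thesis by (simp add: add.commute)
qed

lemma integrable_lborel_translate:
  fixes f :: "'a::euclidean_space \<Rightarrow> real"
  assumes "f \<in> borel_measurable borel" "integrable lborel f"
  shows "integrable lborel (\<lambda>x. f (x + h))"
proof -
  have "integrable (distr lborel borel ((+) h)) f"
    using assms(2) by (simp only: lborel_distr_plus)
  then show ?thesis
    using assms(1) by (subst (asm) integrable_distr_eq) (auto simp: add.commute)
qed

lemma continuous_compact_support_bounded:
  fixes f :: "'a::euclidean_space \<Rightarrow> real"
  assumes "continuous_on UNIV f" "\<And>x. norm x > R \<Longrightarrow> f x = 0"
  obtains B where "B \<ge> 0" "\<And>x. \<bar>f x\<bar> \<le> B"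
proof -
  have "compact (f ` cball 0 R)"
    by (intro compact_continuous_image continuous_on_subset[OF assms(1)]) auto
  then have "bounded (f ` cball 0 R)" by (rule compact_imp_bounded)
  then obtain B where B: "\<forall>x\<in>cball 0 R. \<bar>f x\<bar> \<le> B"
    by (auto simp: bounded_iff)
  then have "\<bar>f x\<bar> \<le> max B 0" for x
    using assms(2)[of x] B by (cases "norm x > R") (auto simp: le_max_iff_disj)
  then show ?thesis using that[of "max B 0"] by auto
qed

text \<open>Order one and compact support are what integration by parts and differentiation under
  the integral consume, and this class is closed under products by a single use of the product
  rule.\<close>

definition C1_compact_support :: "('a::euclidean_space \<Rightarrow> real) \<Rightarrow> bool" where
  "C1_compact_support \<phi> \<longleftrightarrow> (\<forall>x. \<phi> differentiable (at x)) \<and>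
     (\<forall>b\<in>Basis. continuous_on UNIV (\<lambda>x. frechet_derivative \<phi> (at x) b)) \<and>
     (\<exists>R. \<forall>x. norm x > R \<longrightarrow> \<phi> x = 0)"

lemma test_function_C1:
  assumes "test_function \<phi>"
  shows "C1_compact_support \<phi>"
proof -
  have "Ck (Suc 0) \<phi>"
    using assms unfolding test_function_def by blast
  moreover have "bounded {x. \<phi> x \<noteq> 0}"
    using assms by (auto simp: test_function_def)
  then obtain R where "\<forall>x\<in>{x. \<phi> x \<noteq> 0}. norm x \<le> R"
    by (auto simp: bounded_iff)
  then have "\<forall>x. norm x > R \<longrightarrow> \<phi> x = 0" by force
  ultimately show ?thesis
    unfolding C1_compact_support_def by auto
qed

lemma frechet_derivative_Basis_sum:
  fixes \<phi> :: "'a::euclidean_space \<Rightarrow> real"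
  assumes "\<phi> differentiable (at x)"
  shows "frechet_derivative \<phi> (at x) y = (\<Sum>b\<in>Basis. (y \<bullet> b) * frechet_derivative \<phi> (at x) b)"
proof -
  interpret linear "frechet_derivative \<phi> (at x)"
    by (rule linear_frechet_derivative[OF assms])
  have "frechet_derivative \<phi> (at x) y = frechet_derivative \<phi> (at x) (\<Sum>b\<in>Basis. (y \<bullet> b) *\<^sub>R b)"
    by (simp add: euclidean_representation)
  then show ?thesis by (simp add: sum scaleR)
qed

context
  fixes \<phi> :: "'a::euclidean_space \<Rightarrow> real"
  assumes \<phi>: "C1_compact_support \<phi>"
begin

lemma C1_has_derivative: "(\<phi> has_derivative frechet_derivative \<phi> (at x)) (at x)"
  using \<phi> by (simp add: C1_compact_support_def frechet_derivative_works[symmetric])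

lemma C1_continuous: "continuous_on UNIV \<phi>"
  using \<phi> by (auto simp: C1_compact_support_def intro: continuous_at_imp_continuous_on differentiable_imp_continuous_within)

lemma C1_derivative_continuous: "continuous_on UNIV (\<lambda>x. frechet_derivative \<phi> (at x) y)"
  using \<phi> frechet_derivative_Basis_sum[of \<phi> _ y]
  by (auto simp: C1_compact_support_def intro!: continuous_intros)

lemma C1_measurable [measurable]: "\<phi> \<in> borel_measurable borel"
  by (rule borel_measurable_continuous_onI[OF C1_continuous])

lemma C1_derivative_measurable [measurable]: "(\<lambda>x. frechet_derivative \<phi> (at x) y) \<in> borel_measurable borel"
  by (rule borel_measurable_continuous_onI[OF C1_derivative_continuous])

lemma C1_derivative_zero:
  assumes "\<And>x. norm x > R \<Longrightarrow> \<phi> x = 0" "norm x > R"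
  shows "frechet_derivative \<phi> (at x) = (\<lambda>h. 0)"
proof -
  have "((\<lambda>x. 0) has_derivative (\<lambda>h. 0)) (at x)" by simp
  moreover have "open {x::'a. R < norm x}"
    by (intro open_Collect_less continuous_intros)
  ultimately have "(\<phi> has_derivative (\<lambda>h. 0)) (at x)"
    by (rule has_derivative_transform_within_open) (use assms in auto)
  then show ?thesis by (rule frechet_derivative_eqI)
qed

lemma C1_bounded_derivative:
  obtains B where "B \<ge> 0" "\<And>x. \<bar>frechet_derivative \<phi> (at x) y\<bar> \<le> B"
proof -
  obtain R where R: "\<And>x. norm x > R \<Longrightarrow> \<phi> x = 0"
    using \<phi> by (auto simp: C1_compact_support_def)
  have "frechet_derivative \<phi> (at x) y = 0" if "norm x > R" for x
    using C1_derivative_zero[OF R that] by simp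
  from continuous_compact_support_bounded[OF C1_derivative_continuous this]
  show ?thesis using that by blast
qed

text \<open>Differentiation under the integral is checked along arbitrary sequences of increments,
  so that dominated convergence applies. The difference quotients of \<open>\<phi>\<close> share a
  Lipschitz bound and vanish off one common ball, hence local integrability of \<open>u\<close>
  gives the majorant.\<close>

lemma has_derivative_integral_translate:
  fixes u :: "'a \<Rightarrow> real"
  assumes u [measurable]: "u \<in> borel_measurable borel"
    and loc: "\<And>R. integrable lborel (\<lambda>x. indicator (cball 0 R) x * u x)"
  shows "((\<lambda>t. \<integral>x. u x * \<phi> (x + t *\<^sub>R y) \<partial>lborel) has_real_derivative
     (\<integral>x. u x * frechet_derivative \<phi> (at (x + t *\<^sub>R y)) y \<partial>lborel)) (at t)"
proof -
  define D where "D = (\<lambda>x. frechet_derivative \<phi> (at x) y)"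
  obtain R where R: "\<And>x. norm x > R \<Longrightarrow> \<phi> x = 0"
    using \<phi> by (auto simp: C1_compact_support_def)
  obtain L where L: "L \<ge> 0" "\<And>x. \<bar>D x\<bar> \<le> L"
    unfolding D_def using C1_bounded_derivative[of y] by blast
  obtain L0 where L0: "L0 \<ge> 0" "\<And>x. \<bar>\<phi> x\<bar> \<le> L0"
    using continuous_compact_support_bounded[OF C1_continuous R] by blast
  have D [measurable]: "D \<in> borel_measurable borel"
    unfolding D_def by measurable
  have line: "((\<lambda>s. \<phi> (x + s *\<^sub>R y)) has_real_derivative D (x + s *\<^sub>R y)) (at s)" for x s
  proof -
    have "((\<lambda>s. \<phi> (x + s *\<^sub>R y)) has_derivative (\<lambda>h. frechet_derivative \<phi> (at (x + s *\<^sub>R y)) (h *\<^sub>R y))) (at s)"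
      by (rule has_derivative_compose[of "\<lambda>s. x + s *\<^sub>R y" "\<lambda>h. h *\<^sub>R y" s UNIV \<phi>, OF _ C1_has_derivative])
        (auto intro!: derivative_eq_intros)
    moreover have "linear (frechet_derivative \<phi> (at (x + s *\<^sub>R y)))"
      using C1_has_derivative by (rule has_derivative_linear)
    ultimately show ?thesis
      by (simp add: has_field_derivative_def D_def linear_scale mult.commute[of _ "frechet_derivative _ _ _"])
  qed
  have lip: "\<bar>\<phi> (x + s *\<^sub>R y) - \<phi> (x + t *\<^sub>R y)\<bar> \<le> L * \<bar>s - t\<bar>" for x s t
    using field_differentiable_bound[of UNIV "\<lambda>s. \<phi> (x + s *\<^sub>R y)" "\<lambda>s. D (x + s *\<^sub>R y)" L s t] line L
    by simp
  \<comment> \<open>Shifts of length at most \<open>B * norm y\<close> cannot bring a point this far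
    out back into the ball that carries the support of \<open>\<phi>\<close>.\<close>
  have far: "norm (x + s *\<^sub>R y) > R" if "norm x > R + B * norm y" "\<bar>s\<bar> \<le> B" for x s B
  proof -
    have "norm x \<le> norm (x + s *\<^sub>R y) + norm (s *\<^sub>R y)"
      using norm_triangle_ineq4[of "x + s *\<^sub>R y" "s *\<^sub>R y"] by simp
    moreover have "norm (s *\<^sub>R y) \<le> B * norm y"
      using that by (simp add: mult_right_mono)
    ultimately show ?thesis using that by linarith
  qed
  have int\<phi>: "integrable lborel (\<lambda>x. u x * \<phi> (x + s *\<^sub>R y))" for s
  proof (rule Bochner_Integration.integrable_bound)
    show "integrable lborel (\<lambda>x. L0 * (indicator (cball 0 (R + \<bar>s\<bar> * norm y)) x * u x))"
      by (intro integrable_mult_right loc)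
    show "AE x in lborel. norm (u x * \<phi> (x + s *\<^sub>R y)) \<le>
        norm (L0 * (indicator (cball 0 (R + \<bar>s\<bar> * norm y)) x * u x))"
    proof (rule AE_I2)
      fix x
      show "norm (u x * \<phi> (x + s *\<^sub>R y)) \<le> norm (L0 * (indicator (cball 0 (R + \<bar>s\<bar> * norm y)) x * u x))"
        using far[of "\<bar>s\<bar>" x s] R[of "x + s *\<^sub>R y"] L0(1) L0(2)[of "x + s *\<^sub>R y"]
        by (auto simp: indicator_def abs_mult mult_right_mono mult.commute[of "\<bar>u x\<bar>"])
    qed
  qed measurable
  show ?thesis
    unfolding DERIV_def tendsto_at_iff_sequentially comp_def
  proof (intro allI impI)
    fix X :: "nat \<Rightarrow> real"
    assume X0: "\<forall>i. X i \<in> UNIV - {0}" and X: "X \<longlonglongrightarrow> 0"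
    \<comment> \<open>Boundedness covers the early increments too, so one ball of radius
      \<open>Q\<close> serves every \<open>n\<close>.\<close>
    have "Bseq X"
      using X by (auto intro: convergent_imp_Bseq convergentI)
    then obtain B where B: "B > 0" "\<forall>n. \<bar>X n\<bar> \<le> B"
      by (auto elim: BseqE)
    have eq: "((\<integral>x. u x * \<phi> (x + (t + X n) *\<^sub>R y) \<partial>lborel) - (\<integral>x. u x * \<phi> (x + t *\<^sub>R y) \<partial>lborel)) / X n
      = (\<integral>x. u x * ((\<phi> (x + (t + X n) *\<^sub>R y) - \<phi> (x + t *\<^sub>R y)) / X n) \<partial>lborel)" for n
      by (simp add: Bochner_Integration.integral_diff[OF int\<phi> int\<phi>, symmetric] diff_divide_distrib right_diff_distrib
          flip: integral_divide_zero)
    define Q where "Q = R + (\<bar>t\<bar> + B) * norm y"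
    have "(\<lambda>n. \<integral>x. u x * ((\<phi> (x + (t + X n) *\<^sub>R y) - \<phi> (x + t *\<^sub>R y)) / X n) \<partial>lborel)
      \<longlonglongrightarrow> (\<integral>x. u x * D (x + t *\<^sub>R y) \<partial>lborel)"
    proof (rule integral_dominated_convergence)
      show "integrable lborel (\<lambda>x. L * \<bar>indicator (cball 0 Q) x * u x\<bar>)"
        by (intro integrable_mult_right integrable_abs loc)
      show "AE x in lborel. (\<lambda>n. u x * ((\<phi> (x + (t + X n) *\<^sub>R y) - \<phi> (x + t *\<^sub>R y)) / X n))
          \<longlonglongrightarrow> u x * D (x + t *\<^sub>R y)"
      proof (rule AE_I2)
        fix x
        have "(\<lambda>n. (\<phi> (x + (t + X n) *\<^sub>R y) - \<phi> (x + t *\<^sub>R y)) / X n) \<longlonglongrightarrow> D (x + t *\<^sub>R y)"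
          using line[of x t] X0 X unfolding DERIV_def tendsto_at_iff_sequentially comp_def by blast
        then show "(\<lambda>n. u x * ((\<phi> (x + (t + X n) *\<^sub>R y) - \<phi> (x + t *\<^sub>R y)) / X n))
          \<longlonglongrightarrow> u x * D (x + t *\<^sub>R y)"
          by (rule tendsto_mult_left)
      qed
      fix n
      show "AE x in lborel. norm (u x * ((\<phi> (x + (t + X n) *\<^sub>R y) - \<phi> (x + t *\<^sub>R y)) / X n))
          \<le> L * \<bar>indicator (cball 0 Q) x * u x\<bar>"
      proof (rule AE_I2)
        fix x
        have Xn: "X n \<noteq> 0" using X0 by auto
        have bound: "\<bar>u x * d\<bar> \<le> L * \<bar>u x\<bar>" if "\<bar>d\<bar> \<le> L" for d
          using mult_left_mono[OF that, of "\<bar>u x\<bar>"] by (simp add: abs_mult mult.commute)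
        have le: "\<bar>u x * ((\<phi> (x + (t + X n) *\<^sub>R y) - \<phi> (x + t *\<^sub>R y)) / X n)\<bar> \<le> L * \<bar>u x\<bar>"
          by (rule bound) (use lip[of x "t + X n" t] Xn in \<open>simp add: field_simps\<close>)
        moreover have "\<phi> (x + (t + X n) *\<^sub>R y) = 0 \<and> \<phi> (x + t *\<^sub>R y) = 0" if "x \<notin> cball 0 Q"
          using far[of "\<bar>t\<bar> + B" x "t + X n"] far[of "\<bar>t\<bar> + B" x t] that B(1) spec[OF B(2), of n]
          by (auto simp: Q_def R)
        ultimately show "norm (u x * ((\<phi> (x + (t + X n) *\<^sub>R y) - \<phi> (x + t *\<^sub>R y)) / X n))
          \<le> L * \<bar>indicator (cball 0 Q) x * u x\<bar>"
          using le by (cases "x \<in> cball 0 Q") auto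
      qed
    qed measurable
    then show "(\<lambda>n. ((\<integral>x. u x * \<phi> (x + (t + X n) *\<^sub>R y) \<partial>lborel) - (\<integral>x. u x * \<phi> (x + t *\<^sub>R y) \<partial>lborel)) / X n)
      \<longlonglongrightarrow> (\<integral>x. u x * frechet_derivative \<phi> (at (x + t *\<^sub>R y)) y \<partial>lborel)"
      unfolding eq D_def .
  qed
qed

text \<open>Differentiation under the integral is applied to the constant \<open>u = 1\<close>,
  which is locally integrable although not integrable: the integral of a translate of
  \<open>\<phi>\<close> does not depend on the shift, so its derivative vanishes.\<close>

lemma integral_C1_derivative: "(\<integral>x. frechet_derivative \<phi> (at x) y \<partial>lborel) = 0"
proof -
  have "integrable lborel (\<lambda>x::'a. indicator (cball 0 R) x * (1::real))" for R
    by (simp add: integrable_indicator_iff emeasure_bounded_finite[simplified])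
  from has_derivative_integral_translate[OF _ this, of y 0]
  have "((\<lambda>t. \<integral>x. \<phi> (x + t *\<^sub>R y) \<partial>lborel) has_real_derivative
     (\<integral>x. frechet_derivative \<phi> (at x) y \<partial>lborel)) (at 0)" by simp
  moreover have "(\<integral>x. \<phi> (x + h) \<partial>lborel) = (\<integral>x. \<phi> x \<partial>lborel)" for h
    by (rule integral_lborel_translate) measurable
  ultimately have "((\<lambda>t. \<integral>x. \<phi> x \<partial>lborel) has_real_derivative
     (\<integral>x. frechet_derivative \<phi> (at x) y \<partial>lborel)) (at 0)" by simp
  then show ?thesis using DERIV_const DERIV_unique by blast
qed

end

subsection \<open>Square-integrable functions\<close>

lemma square_integrable_real_iff:
  "square_integrable f \<longleftrightarrow> f \<in> borel_measurable borel \<and> integrable lborel (\<lambda>x. (f x :: real)\<^sup>2)"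
  by (simp add: square_integrable_def)

lemma square_integrable_mult:
  fixes f g :: "'a::euclidean_space \<Rightarrow> real"
  assumes "square_integrable f" "square_integrable g"
  shows "integrable lborel (\<lambda>x. f x * g x)"
proof (rule Bochner_Integration.integrable_bound)
  show "integrable lborel (\<lambda>x. (f x)\<^sup>2 + (g x)\<^sup>2)"
    using assms by (auto simp: square_integrable_real_iff)
  have "\<bar>a * b\<bar> \<le> a\<^sup>2 + b\<^sup>2" for a b :: real
    using sum_squares_bound[of "\<bar>a\<bar>" "\<bar>b\<bar>"] mult_nonneg_nonneg[OF abs_ge_zero[of a] abs_ge_zero[of b]]
    unfolding abs_mult power2_abs by linarith
  then show "AE x in lborel. norm (f x * g x) \<le> norm ((f x)\<^sup>2 + (g x)\<^sup>2)"
    by simp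
qed (use assms in \<open>auto simp: square_integrable_real_iff\<close>)

lemma square_integrable_add:
  fixes f g :: "'a::euclidean_space \<Rightarrow> real"
  assumes "square_integrable f" "square_integrable g"
  shows "square_integrable (\<lambda>x. f x + g x)"
  using assms square_integrable_mult[OF assms]
  by (auto simp: square_integrable_real_iff power2_sum mult.assoc)

lemma square_integrable_cmult:
  fixes f :: "'a::euclidean_space \<Rightarrow> real"
  assumes "square_integrable f"
  shows "square_integrable (\<lambda>x. c * f x)"
  using assms by (auto simp: square_integrable_real_iff power_mult_distrib)

lemma square_integrable_diff:
  fixes f g :: "'a::euclidean_space \<Rightarrow> real"
  assumes "square_integrable f" "square_integrable g"
  shows "square_integrable (\<lambda>x. f x - g x)"
  using square_integrable_add[OF assms(1) square_integrable_cmult[OF assms(2), of "-1"]] by simp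

lemma square_integrable_translate:
  fixes f :: "'a::euclidean_space \<Rightarrow> real"
  assumes "square_integrable f"
  shows "square_integrable (\<lambda>x. f (x + h))"
  using assms integrable_lborel_translate[of "\<lambda>x. (f x)\<^sup>2" h]
  by (auto simp: square_integrable_real_iff)

text \<open>The integral of the square of \<open>f + t * g\<close> is a quadratic polynomial in
  \<open>t\<close> that never becomes negative.\<close>

lemma Cauchy_Schwarz_integral:
  fixes f g :: "'a::euclidean_space \<Rightarrow> real"
  assumes "square_integrable f" "square_integrable g"
  shows "(\<integral>x. f x * g x \<partial>lborel)\<^sup>2 \<le> (\<integral>x. (f x)\<^sup>2 \<partial>lborel) * (\<integral>x. (g x)\<^sup>2 \<partial>lborel)"
proof -
  define A B C where "A = (\<integral>x. (f x)\<^sup>2 \<partial>lborel)" "B = (\<integral>x. f x * g x \<partial>lborel)"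
    "C = (\<integral>x. (g x)\<^sup>2 \<partial>lborel)"
  have quad: "0 \<le> A + 2 * t * B + t\<^sup>2 * C" for t
  proof -
    have "0 \<le> (\<integral>x. (f x + t * g x)\<^sup>2 \<partial>lborel)" by simp
    also have "\<dots> = (\<integral>x. (f x)\<^sup>2 + (2 * t) * (f x * g x) + t\<^sup>2 * (g x)\<^sup>2 \<partial>lborel)"
      by (simp add: power2_sum power_mult_distrib algebra_simps)
    also have "\<dots> = A + 2 * t * B + t\<^sup>2 * C"
      using assms square_integrable_mult[OF assms]
      by (simp add: A_B_C_def square_integrable_real_iff del: mult_numeral_left_semiring_numeral)
    finally show ?thesis .
  qed
  have "C \<ge> 0" by (simp add: A_B_C_def)
  show ?thesis
  proof (cases "C = 0")
    case True
    have "B = 0"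
    proof (rule ccontr)
      assume "B \<noteq> 0"
      \<comment> \<open>For \<open>C = 0\<close> the quadratic is affine in \<open>t\<close>, and
        this \<open>t\<close> gives it the value \<open>-1\<close>.\<close>
      with quad[of "- (A + 1) / (2 * B)"] True show False by (simp add: field_simps)
    qed
    with True show ?thesis by (simp add: A_B_C_def)
  next
    case False
    with \<open>C \<ge> 0\<close> have "C > 0" by simp
    with quad[of "- B / C"] have "B\<^sup>2 \<le> A * C"
      by (simp add: field_simps power2_eq_square)
    then show ?thesis by (simp add: A_B_C_def)
  qed
qed

section \<open>Classical functions of compact support as elements of \<open>H1\<close>\<close>

lemma integrable_continuous_compact_support:
  fixes f :: "'a::euclidean_space \<Rightarrow> real"
  assumes "continuous_on UNIV f" "\<And>x. norm x > R \<Longrightarrow> f x = 0"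
  shows "integrable lborel f"
proof -
  have "integrable lborel (\<lambda>x. indicator (cball 0 R) x *\<^sub>R f x)"
    by (rule borel_integrable_compact) (auto intro: continuous_on_subset[OF assms(1)])
  moreover have "(\<lambda>x. indicator (cball 0 R) x *\<^sub>R f x) = f"
    using assms(2) by (auto simp: indicator_def fun_eq_iff not_le)
  ultimately show ?thesis by simp
qed

lemma square_integrable_continuous_compact_support:
  fixes f :: "'a::euclidean_space \<Rightarrow> real"
  assumes "continuous_on UNIV f" "\<And>x. norm x > R \<Longrightarrow> f x = 0"
  shows "square_integrable f"
  using integrable_continuous_compact_support[of "\<lambda>x. (f x)\<^sup>2" R] assms
  by (auto simp: square_integrable_real_iff intro!: borel_measurable_continuous_onI continuous_intros)

lemma C1_square_integrable:
  assumes "C1_compact_support \<phi>"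
  shows "square_integrable \<phi>" "square_integrable (\<lambda>x. frechet_derivative \<phi> (at x) y)"
proof -
  obtain R where R: "\<And>x. norm x > R \<Longrightarrow> \<phi> x = 0"
    using assms by (auto simp: C1_compact_support_def)
  show "square_integrable \<phi>"
    using C1_continuous[OF assms] R by (rule square_integrable_continuous_compact_support)
  show "square_integrable (\<lambda>x. frechet_derivative \<phi> (at x) y)"
    using C1_derivative_continuous[OF assms]
    by (rule square_integrable_continuous_compact_support[of _ R])
      (simp add: C1_derivative_zero[OF assms R])
qed

lemma C1_mult_derivative:
  assumes "C1_compact_support \<phi>" "C1_compact_support \<psi>"
  shows "frechet_derivative (\<lambda>x. \<phi> x * \<psi> x) (at x) y =
     \<phi> x * frechet_derivative \<psi> (at x) y + frechet_derivative \<phi> (at x) y * \<psi> x"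
  by (simp add: frechet_derivative_eqI[OF has_derivative_mult[OF C1_has_derivative[OF assms(1)] C1_has_derivative[OF assms(2)]]])

lemma C1_mult:
  assumes "C1_compact_support \<phi>" "C1_compact_support \<psi>"
  shows "C1_compact_support (\<lambda>x. \<phi> x * \<psi> x)"
  unfolding C1_compact_support_def C1_mult_derivative[OF assms]
proof (intro conjI allI ballI)
  show "(\<lambda>x. \<phi> x * \<psi> x) differentiable at x" for x
    using assms by (intro differentiable_mult) (auto simp: C1_compact_support_def)
  show "continuous_on UNIV (\<lambda>x. \<phi> x * frechet_derivative \<psi> (at x) b + frechet_derivative \<phi> (at x) b * \<psi> x)" for b
    using assms by (intro continuous_intros C1_continuous C1_derivative_continuous)
  show "\<exists>R. \<forall>x. R < norm x \<longrightarrow> \<phi> x * \<psi> x = 0"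
    using assms by (auto simp: C1_compact_support_def)
qed

lemma C1_integration_by_parts:
  assumes "C1_compact_support \<phi>" "C1_compact_support \<psi>"
  shows "(\<integral>x. \<phi> x * frechet_derivative \<psi> (at x) y \<partial>lborel) = - (\<integral>x. frechet_derivative \<phi> (at x) y * \<psi> x \<partial>lborel)"
  using integral_C1_derivative[OF C1_mult[OF assms], of y] assms
  unfolding C1_mult_derivative[OF assms]
  by (subst (asm) Bochner_Integration.integral_add)
    (auto intro: square_integrable_mult C1_square_integrable)

text \<open>The classical gradient, assembled from the partial derivatives, is a weak gradient by
  integration by parts. \<open>weak_gradient\<close> may select another representative, but
  membership asks only for existence.\<close>

lemma C1_in_H1:
  fixes \<phi> :: "'a::euclidean_space \<Rightarrow> real"
  assumes "C1_compact_support \<phi>"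
  shows "\<phi> \<in> H1"
proof -
  define g where "g x = (\<Sum>b\<in>Basis. frechet_derivative \<phi> (at x) b *\<^sub>R b)" for x :: 'a
  have g_inner: "g x \<bullet> b = frechet_derivative \<phi> (at x) b" if "b \<in> Basis" for x b
    using that by (simp add: g_def inner_sum_left inner_Basis if_distrib[of "\<lambda>a. _ * a"] cong: if_cong)
  have [measurable]: "g \<in> borel_measurable borel"
    unfolding g_def using C1_derivative_measurable[OF assms] by measurable
  have "(\<lambda>x. (norm (g x))\<^sup>2) = (\<lambda>x. \<Sum>b\<in>Basis. (frechet_derivative \<phi> (at x) b)\<^sup>2)"
    unfolding power2_norm_eq_inner by (subst euclidean_inner) (auto simp: g_inner power2_eq_square)
  then have "square_integrable g"
    using C1_square_integrable(2)[OF assms]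
    by (auto simp: square_integrable_def square_integrable_real_iff)
  moreover have "has_weak_gradient \<phi> g"
    unfolding has_weak_gradient_def
    by (auto simp: g_inner C1_integration_by_parts[OF assms test_function_C1])
  ultimately show ?thesis
    using C1_square_integrable(1)[OF assms] by (auto simp: H1_def)
qed

text \<open>This witness shows that the index sets of the infima are nonempty. Positivity on a ball
  passes to products of copies, as \<open>beta_bar\<close> demands.\<close>

lemma H1_positive_on_ball:
  obtains u :: "'a::euclidean_space \<Rightarrow> real" where "u \<in> H1" "\<And>x. norm x < 1 \<Longrightarrow> u x > 0"
proof
  \<comment> \<open>Written in the shape handled by \<open>test_function_polynomial_cutoff\<close>,
    with polynomial, steepness and radius all equal to \<open>1\<close>.\<close>
  let ?u = "\<lambda>x::'a. 1 * flat_exp 0 (1 * (1\<^sup>2 - (norm x)\<^sup>2))"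
  show "?u \<in> H1"
    by (intro C1_in_H1 test_function_C1 test_function_polynomial_cutoff real_polynomial_function.intros) simp
  show "?u x > 0" if "norm x < 1" for x
    using that by (simp add: flat_exp_def power_less_one_iff abs_square_less_1)
qed

lemma not_AE_zero_if_positive_on_ball:
  fixes u :: "'a::euclidean_space \<Rightarrow> real"
  assumes "\<And>x. norm x < 1 \<Longrightarrow> u x > 0"
  shows "\<not> (AE x in lborel. u x = 0)"
proof
  assume "AE x in lborel. u x = 0"
  then have "AE x in lborel. x \<notin> ball (0::'a) 1"
    by eventually_elim (use assms in force)
  then have "emeasure lborel (ball (0::'a) 1) = 0"
    by (subst (asm) AE_iff_measurable[of "ball 0 1"]) auto
  then show False
    using content_ball_pos[of 1 "0::'a"] by (simp add: measure_def)
qed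

subsection \<open>Translation bound for weak gradients\<close>

text \<open>Continuous functions approximate \<open>w\<close> almost everywhere; clamped to
  \<open>[-n, n]\<close>, they are replaced on the ball by polynomials, and the cutoff turns these
  into test functions. The support condition includes the sphere \<open>norm x = n\<close>: every
  cutoff vanishes there, so convergence holds there as well. The bound \<open>n + 1\<close> is the
  clamp plus the polynomial error.\<close>

lemma test_function_bounded_approx:
  fixes w :: "'a::euclidean_space \<Rightarrow> real"
  assumes w: "w \<in> borel_measurable borel" and n: "n > 0"
    and bd: "\<And>x. \<bar>w x\<bar> \<le> n" and supp: "\<And>x. norm x \<ge> n \<Longrightarrow> w x = 0"
  obtains \<phi> where "\<And>k::nat. test_function (\<phi> k)" "AE x in lborel. (\<lambda>k. \<phi> k x) \<longlonglongrightarrow> w x"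
    "\<And>k x. \<bar>\<phi> k x\<bar> \<le> (n + 1) * indicator (cball 0 n) x"
proof -
  have "w measurable_on UNIV"
    by (rule lebesgue_measurable_imp_measurable_on)
      (use w in \<open>auto intro: measurable_completion\<close>)
  then obtain N g where N: "negligible N" and g: "\<And>k::nat. continuous_on UNIV (g k)"
    and lim: "\<And>x. x \<notin> N \<Longrightarrow> (\<lambda>k. g k x) \<longlonglongrightarrow> w x"
    by (auto simp: measurable_on_def)
  \<comment> \<open>Clamping does not change the limit, because \<open>w\<close> obeys the same
    bounds.\<close>
  define h where "h k x = max (- n) (min n (g k x))" for k x
  have h_cont: "continuous_on (cball 0 n) (h k)" for k
    unfolding h_def by (intro continuous_intros continuous_on_subset[OF g]) auto
  have "\<exists>P. real_polynomial_function P \<and> (\<forall>x\<in>cball 0 n. \<bar>h k x - P x\<bar> < 1 / Suc k)" for k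
    using Stone_Weierstrass_real_polynomial_function[OF compact_cball h_cont, of "1 / Suc k"] 
    by (metis of_nat_0_less_iff zero_less_Suc zero_less_divide_1_iff)
  then obtain P where P: "\<And>k. real_polynomial_function (P k)"
    "\<And>k x. norm x \<le> n \<Longrightarrow> \<bar>h k x - P k x\<bar> < 1 / Suc k"
    by (metis mem_cball_0)
  \<comment> \<open>The growing factor \<open>Suc k\<close> drives the cutoff to \<open>1\<close> at
    each point of the open ball.\<close>
  define \<phi> where "\<phi> k x = P k x * flat_exp 0 (Suc k * (n\<^sup>2 - (norm x)\<^sup>2))" for k x
  show ?thesis
  proof
    show "test_function (\<phi> k)" for k
      unfolding \<phi>_def by (rule test_function_polynomial_cutoff[OF P(1)]) simp
    show "\<bar>\<phi> k x\<bar> \<le> (n + 1) * indicator (cball 0 n) x" for k x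
    proof (cases "norm x \<le> n")
      case True
      have "\<bar>h k x\<bar> \<le> n" using n by (auto simp: h_def)
      moreover have "1 / real (Suc k) \<le> 1" by simp
      ultimately have "\<bar>P k x\<bar> \<le> n + 1" using P(2)[OF True, of k] by linarith
      then have "\<bar>P k x\<bar> * flat_exp 0 (Suc k * (n\<^sup>2 - (norm x)\<^sup>2)) \<le> (n + 1) * 1"
        using flat_exp_0_bounds n by (intro mult_mono) auto
      with True show ?thesis
        using flat_exp_0_bounds(1) by (simp add: \<phi>_def abs_mult)
    next
      case False
      then have "\<not> n\<^sup>2 > (norm x)\<^sup>2"
        using n by (simp add: not_less power_mono)
      then have "\<phi> k x = 0" by (simp add: \<phi>_def flat_exp_def zero_less_mult_iff)
      with False show ?thesis by simp
    qed
    have "AE x in lebesgue. x \<notin> N"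
      using N by (simp add: negligible_iff_null_sets AE_not_in)
    then have "AE x in lborel. x \<notin> N" by (simp add: AE_completion_iff)
    then show "AE x in lborel. (\<lambda>k. \<phi> k x) \<longlonglongrightarrow> w x"
    proof eventually_elim
      case (elim x)
      show ?case
      proof (cases "norm x < n")
        case True
        have "(\<lambda>k. h k x) \<longlonglongrightarrow> max (- n) (min n (w x))"
          unfolding h_def by (intro tendsto_intros lim elim)
        then have "(\<lambda>k. h k x) \<longlonglongrightarrow> w x"
          using bd[of x] by (simp add: max_def min_def abs_le_iff split: if_splits)
        moreover have "(\<lambda>k. h k x - P k x) \<longlonglongrightarrow> 0"
        proof (rule Lim_null_comparison)
          show "\<forall>\<^sub>F k in sequentially. norm (h k x - P k x) \<le> 1 / Suc k"
            using P(2)[of x] True by (auto intro!: always_eventually less_imp_le)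
          show "(\<lambda>k. 1 / real (Suc k)) \<longlonglongrightarrow> 0"
            by (rule LIMSEQ_Suc) (rule lim_1_over_n)
        qed
        ultimately have "(\<lambda>k. h k x - (h k x - P k x)) \<longlonglongrightarrow> w x - 0"
          by (rule tendsto_diff)
        then have Plim: "(\<lambda>k. P k x) \<longlonglongrightarrow> w x" by simp
        define c where "c = n\<^sup>2 - (norm x)\<^sup>2"
        have c: "c > 0" using True n by (simp add: c_def power_strict_mono)
        have "(\<lambda>k. exp (- (1 / c) * (1 / real (Suc k)))) \<longlonglongrightarrow> exp (- (1 / c) * 0)"
          by (intro tendsto_intros LIMSEQ_Suc[OF lim_1_over_n])
        moreover have "flat_exp 0 (Suc k * c) = exp (- (1 / c) * (1 / real (Suc k)))" for k
          using c mult_pos_pos[of "real (Suc k)" c] by (simp add: flat_exp_def divide_simps del: of_nat_Suc)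
        ultimately have "(\<lambda>k. flat_exp 0 (Suc k * c)) \<longlonglongrightarrow> 1" by simp
        from tendsto_mult[OF Plim this] show ?thesis
          by (simp add: \<phi>_def c_def)
      next
        case False
        then have "\<not> n\<^sup>2 > (norm x)\<^sup>2"
          using n by (simp add: not_less power_mono)
        then have "\<phi> k x = 0" for k by (simp add: \<phi>_def flat_exp_def zero_less_mult_iff)
        with False supp show ?thesis by simp
      qed
    qed
  qed
qed

lemma square_integrable_indicator_cball:
  "square_integrable (indicator (cball 0 R) :: 'a::euclidean_space \<Rightarrow> real)"
proof -
  have "(indicator (cball 0 R) x :: real)\<^sup>2 = indicator (cball 0 R) x" for x :: 'a
    by (simp add: indicator_def)
  then show ?thesis
    by (simp add: square_integrable_real_iff integrable_indicator_iff emeasure_bounded_finite[simplified] borel_measurable_indicator)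
qed

text \<open>The natural choice of \<open>\<phi>\<close> would be \<open>w\<close> itself. Its
  truncations \<open>v n\<close> are bounded and compactly supported, hence limits of test
  functions; so \<open>\<integral> v^2 \<le> \<integral> w * v \<le> M * sqrt (\<integral>
  v^2)\<close>, which bounds \<open>v n\<close> by \<open>M\<close>, and \<open>n\<close> is sent to
  infinity.\<close>

lemma L2_norm_le_by_duality:
  fixes w :: "'a::euclidean_space \<Rightarrow> real"
  assumes w: "square_integrable w" and M: "M \<ge> 0"
    and dual: "\<And>\<phi>. test_function \<phi> \<Longrightarrow> (\<integral>x. w x * \<phi> x \<partial>lborel) \<le> M * sqrt (\<integral>x. (\<phi> x)\<^sup>2 \<partial>lborel)"
  shows "(\<integral>x. (w x)\<^sup>2 \<partial>lborel) \<le> M\<^sup>2"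
proof -
  have [measurable]: "w \<in> borel_measurable borel"
    using w by (simp add: square_integrable_real_iff)
  \<comment> \<open>The strict inequality makes \<open>v n\<close> vanish on the sphere too, as the
    approximation by test functions demands; \<open>Suc n\<close> keeps the radius positive.\<close>
  define v where "v n x = (if norm x < Suc n then max (- real (Suc n)) (min (Suc n) (w x)) else 0)" for n x
  have v_meas [measurable]: "v n \<in> borel_measurable borel" for n
    unfolding v_def by measurable
  \<comment> \<open>Truncation keeps the sign and does not increase the absolute value.\<close>
  have v_le: "(v n x)\<^sup>2 \<le> w x * v n x" "(v n x)\<^sup>2 \<le> (w x)\<^sup>2" for n x
  proof -
    have "(max (- c) (min c a))\<^sup>2 \<le> a * max (- c) (min c a) \<and> (max (- c) (min c a))\<^sup>2 \<le> a\<^sup>2"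
      if "c > 0" for a c :: real
    proof -
      consider "a < - c" | "- c \<le> a" "a \<le> c" | "a > c" by linarith
      then show ?thesis
      proof cases
        case 1
        have "c * c \<le> c * - a" "c * - a \<le> - a * - a" using 1 that by (intro mult_mono; simp)+
        with 1 that show ?thesis by (simp add: power2_eq_square algebra_simps)
      next
        case 2
        then show ?thesis by (simp add: power2_eq_square)
      next
        case 3
        have "c * c \<le> c * a" "c * a \<le> a * a" using 3 that by (intro mult_mono; simp)+
        then have "c * c \<le> a * a" by linarith
        with 3 that \<open>c * c \<le> c * a\<close> show ?thesis by (simp add: power2_eq_square algebra_simps)
      qed
    qed
    from this[of "real (Suc n)" "w x"]
    show "(v n x)\<^sup>2 \<le> w x * v n x" "(v n x)\<^sup>2 \<le> (w x)\<^sup>2"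
      by (auto simp: v_def)
  qed
  have v_sq: "square_integrable (v n)" for n
    unfolding square_integrable_real_iff
  proof
    show "integrable lborel (\<lambda>x. (v n x)\<^sup>2)"
      by (rule Bochner_Integration.integrable_bound[of _ "\<lambda>x. (w x)\<^sup>2"])
        (use w v_le in \<open>auto simp: square_integrable_real_iff\<close>)
  qed measurable
  have bound: "(\<integral>x. (v n x)\<^sup>2 \<partial>lborel) \<le> M\<^sup>2" for n
  proof -
    let ?n = "real (Suc n)"
    obtain \<phi> where \<phi>: "\<And>k::nat. test_function (\<phi> k)"
      and lim: "AE x in lborel. (\<lambda>k. \<phi> k x) \<longlonglongrightarrow> v n x"
      and bd: "\<And>k x. \<bar>\<phi> k x\<bar> \<le> (?n + 1) * indicator (cball 0 ?n) x"
      by (rule test_function_bounded_approx[of "v n" ?n]) (auto simp: v_def)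
    have [measurable]: "\<phi> k \<in> borel_measurable borel" for k
      using C1_measurable[OF test_function_C1[OF \<phi>]] .
    have sq_ind: "square_integrable (\<lambda>x. (?n + 1) * indicator (cball 0 ?n) x)"
      by (intro square_integrable_cmult square_integrable_indicator_cball)
    have w_abs: "square_integrable (\<lambda>x. \<bar>w x\<bar>)"
      using w by (simp add: square_integrable_real_iff)
    have "(\<lambda>k. \<integral>x. w x * \<phi> k x \<partial>lborel) \<longlonglongrightarrow> (\<integral>x. w x * v n x \<partial>lborel)"
    proof (rule integral_dominated_convergence)
      show "integrable lborel (\<lambda>x. \<bar>w x\<bar> * ((?n + 1) * indicator (cball 0 ?n) x))"
        by (rule square_integrable_mult[OF w_abs sq_ind])
      show "AE x in lborel. (\<lambda>k. w x * \<phi> k x) \<longlonglongrightarrow> w x * v n x"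
        using lim by eventually_elim (rule tendsto_mult_left)
      show "AE x in lborel. norm (w x * \<phi> k x) \<le> \<bar>w x\<bar> * ((?n + 1) * indicator (cball 0 ?n) x)" for k
        using bd by (auto simp: abs_mult intro!: mult_left_mono)
    qed measurable
    moreover have "(\<lambda>k. \<integral>x. (\<phi> k x)\<^sup>2 \<partial>lborel) \<longlonglongrightarrow> (\<integral>x. (v n x)\<^sup>2 \<partial>lborel)"
    proof (rule integral_dominated_convergence)
      show "integrable lborel (\<lambda>x. ((?n + 1) * indicator (cball 0 ?n) x)\<^sup>2)"
        using sq_ind unfolding square_integrable_real_iff by blast
      show "AE x in lborel. (\<lambda>k. (\<phi> k x)\<^sup>2) \<longlonglongrightarrow> (v n x)\<^sup>2"
        using lim by eventually_elim (rule tendsto_power)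
      show "AE x in lborel. norm ((\<phi> k x)\<^sup>2) \<le> ((?n + 1) * indicator (cball 0 ?n) x)\<^sup>2" for k
        using bd power_mono[OF bd, of _ _ 2] by simp
    qed measurable
    then have "(\<lambda>k. M * sqrt (\<integral>x. (\<phi> k x)\<^sup>2 \<partial>lborel)) \<longlonglongrightarrow> M * sqrt (\<integral>x. (v n x)\<^sup>2 \<partial>lborel)"
      by (intro tendsto_intros)
    ultimately have "(\<integral>x. w x * v n x \<partial>lborel) \<le> M * sqrt (\<integral>x. (v n x)\<^sup>2 \<partial>lborel)"
      by (rule LIMSEQ_le) (use dual \<phi> in blast)
    moreover have "(\<integral>x. (v n x)\<^sup>2 \<partial>lborel) \<le> (\<integral>x. w x * v n x \<partial>lborel)"
      using v_sq v_le by (intro integral_mono square_integrable_mult w) (auto simp: square_integrable_real_iff)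
    ultimately have le: "(\<integral>x. (v n x)\<^sup>2 \<partial>lborel) \<le> M * sqrt (\<integral>x. (v n x)\<^sup>2 \<partial>lborel)" by linarith
    define s where "s = sqrt (\<integral>x. (v n x)\<^sup>2 \<partial>lborel)"
    have s: "s \<ge> 0" "s\<^sup>2 = (\<integral>x. (v n x)\<^sup>2 \<partial>lborel)" by (simp_all add: s_def)
    with le have "s * s \<le> M * s" by (simp add: s_def power2_eq_square)
    with s(1) M have "s \<le> M" by (cases "s = 0") auto
    then have "s\<^sup>2 \<le> M\<^sup>2" using s(1) by (rule power_mono)
    with s(2) show ?thesis by simp
  qed
  have "(\<lambda>n. \<integral>x. (v n x)\<^sup>2 \<partial>lborel) \<longlonglongrightarrow> (\<integral>x. (w x)\<^sup>2 \<partial>lborel)"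
  proof (rule integral_dominated_convergence)
    show "integrable lborel (\<lambda>x. (w x)\<^sup>2)" using w by (simp add: square_integrable_real_iff)
    show "AE x in lborel. (\<lambda>n. (v n x)\<^sup>2) \<longlonglongrightarrow> (w x)\<^sup>2"
    proof (rule AE_I2)
      fix x
      obtain m :: nat where m: "real m > max (norm x) \<bar>w x\<bar>"
        using reals_Archimedean2 by blast
      have "\<forall>\<^sub>F n in sequentially. (w x)\<^sup>2 = (v n x)\<^sup>2"
        using eventually_ge_at_top[of m]
      proof eventually_elim
        case (elim n)
        with m have "norm x < Suc n" "\<bar>w x\<bar> < Suc n" by linarith+
        then show ?case by (simp add: v_def max_def min_def abs_less_iff)
      qed
      then show "(\<lambda>n. (v n x)\<^sup>2) \<longlonglongrightarrow> (w x)\<^sup>2"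
        by (rule Lim_transform_eventually[OF tendsto_const])
    qed
    show "AE x in lborel. norm ((v n x)\<^sup>2) \<le> (w x)\<^sup>2" for n
      using v_le by simp
  qed measurable
  then show ?thesis
    by (rule LIMSEQ_le_const2) (use bound in blast)
qed

text \<open>The translation argument differentiates along an arbitrary \<open>y\<close>, whereas
  \<open>has_weak_gradient\<close> speaks of basis vectors; linearity connects the two.\<close>

lemma has_weak_gradient_direction:
  fixes u :: "'a::euclidean_space \<Rightarrow> real"
  assumes u: "square_integrable u" and g: "square_integrable g" and wg: "has_weak_gradient u g"
    and \<phi>: "test_function \<phi>"
  shows "(\<integral>x. u x * frechet_derivative \<phi> (at x) y \<partial>lborel) = - (\<integral>x. (g x \<bullet> y) * \<phi> x \<partial>lborel)"
proof -
  note C1 = test_function_C1[OF \<phi>]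
  have gb: "square_integrable (\<lambda>x. g x \<bullet> b)" if "b \<in> Basis" for b
    unfolding square_integrable_real_iff
  proof
    have [measurable]: "g \<in> borel_measurable borel" using g by (simp add: square_integrable_def)
    show "(\<lambda>x. g x \<bullet> b) \<in> borel_measurable borel" by measurable
    show "integrable lborel (\<lambda>x. (g x \<bullet> b)\<^sup>2)"
    proof (rule Bochner_Integration.integrable_bound)
      show "integrable lborel (\<lambda>x. (norm (g x))\<^sup>2)" using g by (simp add: square_integrable_def)
      show "AE x in lborel. norm ((g x \<bullet> b)\<^sup>2) \<le> norm ((norm (g x))\<^sup>2)"
        using power_mono[OF Basis_le_norm[OF that], where n = 2] by auto
    qed measurable
  qed
  have "(\<integral>x. u x * frechet_derivative \<phi> (at x) y \<partial>lborel)
      = (\<integral>x. (\<Sum>b\<in>Basis. (y \<bullet> b) * (u x * frechet_derivative \<phi> (at x) b)) \<partial>lborel)"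
    using C1 by (subst frechet_derivative_Basis_sum) (auto simp: C1_compact_support_def sum_distrib_left mult_ac)
  also have "\<dots> = (\<Sum>b\<in>Basis. (y \<bullet> b) * (\<integral>x. u x * frechet_derivative \<phi> (at x) b \<partial>lborel))"
    by (subst Bochner_Integration.integral_sum) (auto intro!: integrable_mult_right square_integrable_mult u C1_square_integrable(2)[OF C1])
  also have "\<dots> = (\<Sum>b\<in>Basis. - ((y \<bullet> b) * (\<integral>x. (g x \<bullet> b) * \<phi> x \<partial>lborel)))"
    using wg \<phi> by (auto simp: has_weak_gradient_def)
  also have "\<dots> = - (\<integral>x. (\<Sum>b\<in>Basis. (y \<bullet> b) * ((g x \<bullet> b) * \<phi> x)) \<partial>lborel)"
    by (subst Bochner_Integration.integral_sum)
      (auto intro!: integrable_mult_right square_integrable_mult gb C1_square_integrable(1)[OF C1] simp: sum_negf)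
  also have "(\<lambda>x. \<Sum>b\<in>Basis. (y \<bullet> b) * ((g x \<bullet> b) * \<phi> x)) = (\<lambda>x. (g x \<bullet> y) * \<phi> x)"
    by (subst (2) euclidean_inner) (simp add: sum_distrib_left sum_distrib_right mult_ac)
  finally show ?thesis .
qed

text \<open>The shift moves onto the test function: the increment paired with \<open>\<phi>\<close>
  is \<open>F 1 - F 0\<close>, where \<open>F t\<close> pairs \<open>u\<close> with
  \<open>\<phi>\<close> translated by \<open>- t * y\<close>. The weak gradient turns
  \<open>F'\<close> into a pairing of \<open>g \<bullet> y\<close> with a translate of
  \<open>\<phi>\<close>, and Cauchy-Schwarz bounds it uniformly in \<open>t\<close>.\<close>

lemma weak_gradient_translation_bound:
  fixes u :: "'a::euclidean_space \<Rightarrow> real"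
  assumes u: "square_integrable u" and g: "square_integrable g" and wg: "has_weak_gradient u g"
  shows "(\<integral>x. (u (x + y) - u x)\<^sup>2 \<partial>lborel) \<le> (norm y)\<^sup>2 * (\<integral>x. (norm (g x))\<^sup>2 \<partial>lborel)"
proof -
  define G where "G = (\<integral>x. (norm (g x))\<^sup>2 \<partial>lborel)"
  have [measurable]: "u \<in> borel_measurable borel" "g \<in> borel_measurable borel"
    using u g by (auto simp: square_integrable_def)
  have G: "G \<ge> 0" by (simp add: G_def)
  have "(\<integral>x. (u (x + y) - u x)\<^sup>2 \<partial>lborel) \<le> (norm y * sqrt G)\<^sup>2"
  proof (rule L2_norm_le_by_duality)
    show "square_integrable (\<lambda>x. u (x + y) - u x)"
      by (intro square_integrable_diff square_integrable_translate u)
    fix \<phi> :: "'a \<Rightarrow> real" assume \<phi>: "test_function \<phi>"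
    note C1 = test_function_C1[OF \<phi>]
    define N where "N = (\<integral>x. (\<phi> x)\<^sup>2 \<partial>lborel)"
    define F where "F t = (\<integral>x. u x * \<phi> (x + t *\<^sub>R (- y)) \<partial>lborel)" for t
    define F' where "F' t = (\<integral>x. u x * frechet_derivative \<phi> (at (x + t *\<^sub>R (- y))) (- y) \<partial>lborel)" for t
    have "integrable lborel (\<lambda>x. indicator (cball 0 R) x * u x)" for R
      by (intro square_integrable_mult square_integrable_indicator_cball u)
    then have der: "(F has_real_derivative F' t) (at t)" for t
      unfolding F_def F'_def by (intro has_derivative_integral_translate C1) auto
    have bound: "\<bar>F' t\<bar> \<le> norm y * sqrt G * sqrt N" for t
    proof -
      define \<psi> where "\<psi> x = \<phi> (x + t *\<^sub>R (- y))" for x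
      have \<psi>: "test_function \<psi>"
        unfolding \<psi>_def by (rule test_function_translate[OF \<phi>])
      have "(\<psi> has_derivative frechet_derivative \<phi> (at (x + t *\<^sub>R (- y)))) (at x)" for x
        unfolding \<psi>_def
        by (rule has_derivative_compose[of "\<lambda>x. x + t *\<^sub>R (- y)" "\<lambda>h. h" x UNIV \<phi>, OF _ C1_has_derivative[OF C1]])
          (auto intro!: derivative_eq_intros)
      then have "frechet_derivative \<psi> (at x) = frechet_derivative \<phi> (at (x + t *\<^sub>R (- y)))" for x
        by (rule frechet_derivative_eqI)
      then have "F' t = - (\<integral>x. (g x \<bullet> (- y)) * \<psi> x \<partial>lborel)"
        using has_weak_gradient_direction[OF u g wg \<psi>, of "- y"] by (simp add: F'_def)
      then have F'_eq: "F' t = (\<integral>x. (g x \<bullet> y) * \<psi> x \<partial>lborel)" by simp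
      have gy: "(g x \<bullet> y)\<^sup>2 \<le> (norm y)\<^sup>2 * (norm (g x))\<^sup>2" for x
        using power_mono[OF Cauchy_Schwarz_ineq2[of "g x" y], of 2] by (simp add: power_mult_distrib mult.commute)
      have int_g: "integrable lborel (\<lambda>x. (norm y)\<^sup>2 * (norm (g x))\<^sup>2)"
        using g by (intro integrable_mult_right) (simp add: square_integrable_def)
      have int_gy: "integrable lborel (\<lambda>x. (g x \<bullet> y)\<^sup>2)"
        by (rule Bochner_Integration.integrable_bound[OF int_g]) (use gy in auto)
      then have "square_integrable (\<lambda>x. g x \<bullet> y)"
        by (simp add: square_integrable_real_iff)
      then have "(F' t)\<^sup>2 \<le> (\<integral>x. (g x \<bullet> y)\<^sup>2 \<partial>lborel) * (\<integral>x. (\<psi> x)\<^sup>2 \<partial>lborel)"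
        unfolding F'_eq using C1_square_integrable(1)[OF test_function_C1[OF \<psi>]]
        by (rule Cauchy_Schwarz_integral)
      also have "(\<integral>x. (\<psi> x)\<^sup>2 \<partial>lborel) = N"
        unfolding \<psi>_def N_def
        by (rule integral_lborel_translate[of "\<lambda>x. (\<phi> x)\<^sup>2"]) (use C1_measurable[OF C1] in measurable)
      also have "(\<integral>x. (g x \<bullet> y)\<^sup>2 \<partial>lborel) \<le> (norm y)\<^sup>2 * G"
        unfolding G_def using integral_mono[OF int_gy int_g gy] by simp
      finally have "(F' t)\<^sup>2 \<le> (norm y)\<^sup>2 * G * N"
        by (simp add: N_def mult_right_mono)
      also have "\<dots> = (norm y * sqrt G * sqrt N)\<^sup>2"
        using G by (simp add: power_mult_distrib N_def)
      finally show ?thesis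
        by (rule abs_le_square_iff[THEN iffD2, THEN order_trans]) (simp add: G N_def)
    qed
    have "\<bar>F 1 - F 0\<bar> \<le> (norm y * sqrt G * sqrt N) * \<bar>1 - 0\<bar>"
      using field_differentiable_bound[of UNIV F F' "norm y * sqrt G * sqrt N" 1 0] der bound by simp
    moreover have "(\<integral>x. (u (x + y) - u x) * \<phi> x \<partial>lborel) = F 1 - F 0"
    proof -
      have "(\<integral>x. (u (x + y) - u x) * \<phi> x \<partial>lborel)
          = (\<integral>x. u (x + y) * \<phi> x \<partial>lborel) - (\<integral>x. u x * \<phi> x \<partial>lborel)"
        unfolding left_diff_distrib
        by (intro Bochner_Integration.integral_diff square_integrable_mult square_integrable_translate u
            C1_square_integrable(1)[OF C1])
      also have "(\<integral>x. u (x + y) * \<phi> x \<partial>lborel) = (\<integral>x. u (x + y) * \<phi> ((x + y) - y) \<partial>lborel)" by simp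
      also have "\<dots> = (\<integral>x. u x * \<phi> (x - y) \<partial>lborel)"
        by (rule integral_lborel_translate[of "\<lambda>x. u x * \<phi> (x - y)"]) (use C1_measurable[OF C1] in measurable)
      finally show ?thesis by (simp add: F_def)
    qed
    ultimately show "(\<integral>x. (u (x + y) - u x) * \<phi> x \<partial>lborel) \<le> norm y * sqrt G * sqrt (\<integral>x. (\<phi> x)\<^sup>2 \<partial>lborel)"
      by (simp add: N_def)
  qed (simp add: G)
  then show ?thesis using G by (simp add: power_mult_distrib G_def)
qed

subsection \<open>Decay of superlevel sets\<close>

text \<open>This is Chebyshev's inequality; \<open>l \<ge> 1\<close> absorbs the factor
  \<open>1 / l^2\<close>, so one bound serves all levels.\<close>

lemma superlevel_measure_le:
  fixes u :: "'a::euclidean_space \<Rightarrow> real"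
  assumes u: "square_integrable u" and l: "l \<ge> 1"
  shows "{x. \<bar>u x\<bar> > l} \<in> fmeasurable lborel" "measure lborel {x. \<bar>u x\<bar> > l} \<le> (\<integral>x. (u x)\<^sup>2 \<partial>lborel)"
proof -
  have [measurable]: "u \<in> borel_measurable borel" using u by (simp add: square_integrable_def)
  let ?L = "{x. \<bar>u x\<bar> > l}"
  have L [measurable]: "?L \<in> sets borel" by measurable
  have le: "indicator ?L x \<le> (u x)\<^sup>2" for x
    using l power_mono[of 1 "\<bar>u x\<bar>" 2] by (auto simp: indicator_def)
  have int_u: "integrable lborel (\<lambda>x. (u x)\<^sup>2)" using u by (simp add: square_integrable_real_iff)
  have int_L: "integrable lborel (indicator ?L :: 'a \<Rightarrow> real)"
    by (rule Bochner_Integration.integrable_bound[OF int_u]) (use le L in \<open>auto simp: indicator_def\<close>)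
  then show "?L \<in> fmeasurable lborel"
    using L by (simp add: integrable_indicator_iff fmeasurable_def)
  have "measure lborel ?L = (\<integral>x. indicator ?L x \<partial>lborel)"
    by simp
  also have "\<dots> \<le> (\<integral>x. (u x)\<^sup>2 \<partial>lborel)"
    by (rule integral_mono[OF int_L int_u le])
  finally show "measure lborel ?L \<le> (\<integral>x. (u x)\<^sup>2 \<partial>lborel)" .
qed

lemma emeasure_lborel_translate:
  fixes A :: "'a::euclidean_space set"
  assumes "A \<in> sets borel"
  shows "emeasure lborel {y. x + y \<in> A} = emeasure lborel A"
proof -
  have "emeasure lborel A = emeasure (distr lborel borel ((+) x)) A"
    by (simp only: lborel_distr_plus)
  also have "\<dots> = emeasure lborel {y. x + y \<in> A}"
    using assms by (subst emeasure_distr) (auto simp: vimage_def)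
  finally show ?thesis ..
qed

text \<open>The double integral \<open>I\<close> of squared increments over all \<open>x\<close> and
  over \<open>y\<close> in the cube is estimated twice. From above, each \<open>y\<close>
  contributes at most \<open>d * \<epsilon>^2 * G\<close>. From below, if \<open>x\<close> lies in
  \<open>E\<close>, then \<open>x + y\<close> avoids \<open>L\<close> for at least half of the cube,
  and there the increment is at least \<open>l\<close>. The volume of the cube cancels.\<close>

lemma superlevel_measure_doubling:
  fixes u :: "'a::euclidean_space \<Rightarrow> real"
  assumes u: "square_integrable u" and l: "l \<ge> 1" and G: "G \<ge> 0"
    and trans: "\<And>y. (\<integral>x. (u (x + y) - u x)\<^sup>2 \<partial>lborel) \<le> (norm y)\<^sup>2 * G"
    and e: "\<epsilon> > 0" "2 * measure lborel {x. \<bar>u x\<bar> > l} \<le> \<epsilon> ^ DIM('a)"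
  shows "measure lborel {x. \<bar>u x\<bar> > 2 * l} * l\<^sup>2 \<le> 2 * real DIM('a) * \<epsilon>\<^sup>2 * G"
proof -
  have [measurable]: "u \<in> borel_measurable borel" using u by (simp add: square_integrable_def)
  define L where "L = {x. \<bar>u x\<bar> > l}"
  define E where "E = {x. \<bar>u x\<bar> > 2 * l}"
  define Q :: "'a set" where "Q = cbox 0 (\<epsilon> *\<^sub>R One)"
  have [measurable]: "L \<in> sets borel" "E \<in> sets borel" "Q \<in> sets borel"
    unfolding L_def E_def Q_def by measurable
  have L_fin: "emeasure lborel L = ennreal (measure lborel L)" and E_fin: "emeasure lborel E = ennreal (measure lborel E)"
    using superlevel_measure_le(1)[OF u, of l] superlevel_measure_le(1)[OF u, of "2 * l"] l
    by (auto simp: L_def E_def fmeasurable_def intro!: emeasure_eq_ennreal_measure)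
  have Q_meas: "emeasure lborel Q = ennreal (\<epsilon> ^ DIM('a))"
    using e(1) by (subst Q_def, subst emeasure_lborel_cbox) auto
  \<comment> \<open>Extended nonnegative integrals allow the order of integration to be exchanged
    without a proof of joint integrability.\<close>
  define I where "I = (\<integral>\<^sup>+y. (\<integral>\<^sup>+x. indicator Q y * ennreal ((u (x + y) - u x)\<^sup>2) \<partial>lborel) \<partial>lborel)"
  have "I \<le> (\<integral>\<^sup>+y. indicator Q y * ennreal (DIM('a) * \<epsilon>\<^sup>2 * G) \<partial>lborel)"
    unfolding I_def
  proof (rule nn_integral_mono)
    fix y :: 'a
    show "(\<integral>\<^sup>+x. indicator Q y * ennreal ((u (x + y) - u x)\<^sup>2) \<partial>lborel) \<le> indicator Q y * ennreal (DIM('a) * \<epsilon>\<^sup>2 * G)"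
    proof (cases "y \<in> Q")
      case True
      have "integrable lborel (\<lambda>x. (u (x + y) - u x)\<^sup>2)"
        using square_integrable_diff[OF square_integrable_translate[OF u] u]
        by (simp add: square_integrable_real_iff)
      then have "(\<integral>\<^sup>+x. ennreal ((u (x + y) - u x)\<^sup>2) \<partial>lborel) = ennreal (\<integral>x. (u (x + y) - u x)\<^sup>2 \<partial>lborel)"
        by (rule nn_integral_eq_integral) simp
      also have "\<dots> \<le> ennreal ((norm y)\<^sup>2 * G)"
        by (rule ennreal_leI[OF trans])
      also have "(norm y)\<^sup>2 \<le> (\<Sum>b\<in>(Basis::'a set). \<epsilon>\<^sup>2)"
        unfolding power2_norm_eq_inner
        by (subst euclidean_inner, intro sum_mono)
          (use True in \<open>auto simp: Q_def mem_box power2_eq_square intro!: mult_mono\<close>)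
      then have "ennreal ((norm y)\<^sup>2 * G) \<le> ennreal (DIM('a) * \<epsilon>\<^sup>2 * G)"
        using G by (intro ennreal_leI mult_right_mono) auto
      finally show ?thesis using True by simp
    qed simp
  qed
  also have "\<dots> = ennreal (DIM('a) * \<epsilon>\<^sup>2 * G) * ennreal (\<epsilon> ^ DIM('a))"
    by (simp add: nn_integral_multc Q_meas mult.commute)
  finally have upper: "I \<le> ennreal (DIM('a) * \<epsilon>\<^sup>2 * G * \<epsilon> ^ DIM('a))"
    using G e(1) by (simp add: ennreal_mult)
  \<comment> \<open>Every translate of \<open>L\<close> has the measure of \<open>L\<close>, so it
    can remove at most half of the cube.\<close>
  have half: "ennreal (\<epsilon> ^ DIM('a) / 2) \<le> emeasure lborel {y \<in> Q. x + y \<notin> L}" for x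
  proof -
    have [measurable]: "{y \<in> Q. x + y \<notin> L} \<in> sets borel" "{y. x + y \<in> L} \<in> sets borel" by measurable
    have "emeasure lborel Q \<le> emeasure lborel ({y \<in> Q. x + y \<notin> L} \<union> {y. x + y \<in> L})"
      by (rule emeasure_mono) auto
    also have "\<dots> \<le> emeasure lborel {y \<in> Q. x + y \<notin> L} + emeasure lborel {y. x + y \<in> L}"
      by (rule emeasure_subadditive) auto
    also have "emeasure lborel {y. x + y \<in> L} = ennreal (measure lborel L)"
      by (subst emeasure_lborel_translate) (auto simp: L_fin)
    also have "\<dots> \<le> ennreal (\<epsilon> ^ DIM('a) / 2)"
      using e(2) by (intro ennreal_leI) (simp add: L_def)
    finally have le: "ennreal (\<epsilon> ^ DIM('a)) \<le> emeasure lborel {y \<in> Q. x + y \<notin> L} + ennreal (\<epsilon> ^ DIM('a) / 2)"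
      by (simp add: Q_meas add_left_mono)
    have "ennreal (\<epsilon> ^ DIM('a)) - ennreal (\<epsilon> ^ DIM('a) / 2) \<le> emeasure lborel {y \<in> Q. x + y \<notin> L}"
      by (rule ennreal_minus_le_iff[THEN iffD2]) (use le in \<open>auto simp: add.commute\<close>)
    then show ?thesis
      using e(1) by (simp add: ennreal_minus)
  qed
  have "ennreal (measure lborel E * l\<^sup>2 * (\<epsilon> ^ DIM('a) / 2)) = emeasure lborel E * (ennreal (l\<^sup>2) * ennreal (\<epsilon> ^ DIM('a) / 2))"
    using e(1) by (simp add: E_fin ennreal_mult[symmetric] mult.assoc)
  also have "\<dots> = (\<integral>\<^sup>+x. indicator E x * (ennreal (l\<^sup>2) * ennreal (\<epsilon> ^ DIM('a) / 2)) \<partial>lborel)"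
    by (simp add: nn_integral_multc)
  also have "\<dots> \<le> (\<integral>\<^sup>+x. (\<integral>\<^sup>+y. indicator Q y * ennreal ((u (x + y) - u x)\<^sup>2) \<partial>lborel) \<partial>lborel)"
  proof (rule nn_integral_mono)
    fix x :: 'a
    show "indicator E x * (ennreal (l\<^sup>2) * ennreal (\<epsilon> ^ DIM('a) / 2))
      \<le> (\<integral>\<^sup>+y. indicator Q y * ennreal ((u (x + y) - u x)\<^sup>2) \<partial>lborel)"
    proof (cases "x \<in> E")
      case True
      have "ennreal (l\<^sup>2) * ennreal (\<epsilon> ^ DIM('a) / 2) \<le> ennreal (l\<^sup>2) * emeasure lborel {y \<in> Q. x + y \<notin> L}"
        by (rule mult_left_mono[OF half]) simp
      also have "\<dots> = (\<integral>\<^sup>+y. ennreal (l\<^sup>2) * indicator {y \<in> Q. x + y \<notin> L} y \<partial>lborel)"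
        by (subst nn_integral_cmult_indicator) auto
      also have "\<dots> \<le> (\<integral>\<^sup>+y. indicator Q y * ennreal ((u (x + y) - u x)\<^sup>2) \<partial>lborel)"
      proof (rule nn_integral_mono)
        fix y :: 'a
        show "ennreal (l\<^sup>2) * indicator {y \<in> Q. x + y \<notin> L} y \<le> indicator Q y * ennreal ((u (x + y) - u x)\<^sup>2)"
        proof (cases "y \<in> Q \<and> x + y \<notin> L")
          case T: True
          with True have "l \<le> \<bar>u (x + y) - u x\<bar>" by (auto simp: L_def E_def)
          then have "l\<^sup>2 \<le> (u (x + y) - u x)\<^sup>2"
            using l by (metis abs_le_square_iff abs_of_nonneg order_trans zero_le_one)
          with T show ?thesis by (simp add: ennreal_leI)
        qed (auto simp: indicator_def)
      qed
      finally show ?thesis using True by simp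
    qed simp
  qed
  also have "\<dots> = I"
    unfolding I_def by (rule lborel_pair.Fubini') measurable
  also note upper
  finally have "measure lborel E * l\<^sup>2 * (\<epsilon> ^ DIM('a) / 2) \<le> DIM('a) * \<epsilon>\<^sup>2 * G * \<epsilon> ^ DIM('a)"
    using G e(1) by (subst (asm) ennreal_le_iff) auto
  then have "(measure lborel E * l\<^sup>2) * \<epsilon> ^ DIM('a) \<le> (2 * DIM('a) * \<epsilon>\<^sup>2 * G) * \<epsilon> ^ DIM('a)"
    by simp
  then show ?thesis
    using e(1) by (simp only: mult_le_cancel_right_pos zero_less_power E_def)
qed

text \<open>The induction closes because the recursion gains the factor
  \<open>2 powr (- k * (2 + 2 * s / d - s))\<close>, which eventually beats the constant \<open>C * 2 powr s\<close>.\<close>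

lemma superlevel_sequence_decay:
  fixes C d s :: real
  assumes C: "C \<ge> 0" and d: "d \<ge> 2" and s: "s > 0" "s < 2 + 2 * s / d"
  obtains B where "B \<ge> 0" "\<And>m k. (\<And>k. 0 \<le> m k \<and> m k \<le> 1) \<Longrightarrow>
      (\<And>k. m (Suc k) \<le> C * 2 powr (- 2 * real k) * m k powr (2 / d)) \<Longrightarrow> m k \<le> B * 2 powr (- real k * s)"
proof -
  define e where "e = 2 + 2 * s / d - s"
  have e: "e > 0" using s by (simp add: e_def)
  have "((\<lambda>k. C * 2 powr s * 2 powr (- real k * e)) \<longlongrightarrow> 0) sequentially"
  proof -
    have "(\<lambda>k. (2 powr (- e)) ^ k) \<longlonglongrightarrow> 0"
      using e by (intro LIMSEQ_realpow_zero) (auto simp: powr_less_one)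
    from tendsto_mult_right_zero[OF this, of "C * 2 powr s"] show ?thesis
      by (simp add: powr_realpow[symmetric] powr_powr mult.commute)
  qed
  then have "\<forall>\<^sub>F k in sequentially. C * 2 powr s * 2 powr (- real k * e) < 1"
    by (rule order_tendstoD) simp
  then obtain k0 where k0: "\<And>k. k \<ge> k0 \<Longrightarrow> C * 2 powr s * 2 powr (- real k * e) < 1"
    by (auto simp: eventually_sequentially)
  \<comment> \<open>Up to \<open>k0\<close> the claim then follows from \<open>m k \<le> 1\<close>
    alone. \<open>B\<close> does not depend on the sequence, which later makes the embedding
    constant uniform in \<open>u\<close>.\<close>
  define B where "B = 2 powr (real k0 * s)"
  have B: "B \<ge> 1" using s by (simp add: B_def ge_one_powr_ge_zero)
  show ?thesis
  proof
    show "B \<ge> 0" using B by simp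
    fix m :: "nat \<Rightarrow> real" and k
    assume m01: "\<And>k. 0 \<le> m k \<and> m k \<le> 1"
      and step: "\<And>k. m (Suc k) \<le> C * 2 powr (- 2 * real k) * m k powr (2 / d)"
    have small: "m k \<le> B * 2 powr (- real k * s)" if "k \<le> k0" for k
    proof -
      have "B * 2 powr (- real k * s) = 2 powr ((real k0 - real k) * s)"
        by (simp add: B_def powr_add[symmetric] algebra_simps)
      moreover have "\<dots> \<ge> 1" using that s by (intro ge_one_powr_ge_zero) auto
      ultimately show ?thesis using m01[of k] by linarith
    qed
    show "m k \<le> B * 2 powr (- real k * s)"
    proof (induction k)
      case 0
      show ?case by (rule small) simp
    next
      case (Suc k)
      show ?case
      proof (cases "Suc k \<le> k0")
        case True
        then show ?thesis by (rule small)
      next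
        case False
        then have "k \<ge> k0" by simp
        have "m k powr (2 / d) \<le> (B * 2 powr (- real k * s)) powr (2 / d)"
          using m01 Suc d by (intro powr_mono2) auto
        also have "\<dots> = B powr (2 / d) * 2 powr (- real k * s * (2 / d))"
          using B by (simp add: powr_mult powr_powr)
        \<comment> \<open>\<open>B \<ge> 1\<close> and \<open>2 / d \<le> 1\<close> absorb the power
          of \<open>B\<close>.\<close>
        also have "\<dots> \<le> B * 2 powr (- real k * s * (2 / d))"
          using B d powr_mono[of "2 / d" 1 B] by (intro mult_right_mono) auto
        finally have "C * 2 powr (- 2 * real k) * m k powr (2 / d)
            \<le> C * 2 powr (- 2 * real k) * (B * 2 powr (- real k * s * (2 / d)))"
          using C by (intro mult_left_mono) auto
        also have "\<dots> = B * 2 powr (- real (Suc k) * s) * (C * 2 powr s * 2 powr (- real k * e))"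
          by (simp add: e_def powr_add[symmetric] algebra_simps diff_divide_distrib)
        also have "\<dots> \<le> B * 2 powr (- real (Suc k) * s) * 1"
          using k0[OF \<open>k \<ge> k0\<close>] B by (intro mult_left_mono) auto
        finally show ?thesis using step[of k] by simp
      qed
    qed
  qed
qed

text \<open>A dyadic majorant takes the place of the exact layer formula: for
  \<open>2^k < a \<le> 2^(k+1)\<close> the \<open>k\<close>-th summand alone dominates, and for
  \<open>a \<le> 1\<close> the square does, because \<open>p \<ge> 2\<close>.\<close>

lemma powr_le_square_plus_layers:
  fixes a p :: real
  assumes "a \<ge> 0" "p \<ge> 2"
  shows "ennreal (a powr p) \<le> ennreal (a\<^sup>2) + (\<Sum>k. ennreal (2 powr (real (Suc k) * p)) * indicator {t. t > 2 ^ k} a)"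
proof (cases "a \<le> 1")
  case True
  have "a powr p \<le> a\<^sup>2"
  proof (cases "a = 0")
    case False
    with assms True have "a powr p \<le> a powr 2" by (intro powr_mono') auto
    also have "a powr 2 = a\<^sup>2" using assms by simp
    finally show ?thesis .
  qed simp
  then have "ennreal (a powr p) \<le> ennreal (a\<^sup>2)" by (rule ennreal_leI)
  then show ?thesis by (simp add: add_increasing2)
next
  case False
  then have a: "a > 1" by simp
  obtain n :: nat where n: "a < 2 ^ n"
    using real_arch_pow[of 2 a] by auto
  \<comment> \<open>Minimality of \<open>j\<close> gives \<open>2^(j-1) < a\<close>; the case
    \<open>j = 0\<close> is excluded by \<open>a > 1\<close>.\<close>
  define j where "j = (LEAST n. a \<le> 2 ^ n)"
  have j: "a \<le> 2 ^ j" unfolding j_def by (rule LeastI[of _ n]) (use n in simp)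
  have "j \<noteq> 0" using j a by (intro notI) simp
  then obtain k where k: "j = Suc k" by (cases j) auto
  have "\<not> a \<le> 2 ^ k"
    using not_less_Least[of k "\<lambda>n. a \<le> 2 ^ n"] k by (simp add: j_def)
  then have lower: "a > 2 ^ k" by simp
  have "a powr p \<le> (2 ^ Suc k) powr p"
    using j k a assms by (intro powr_mono2) auto
  also have "\<dots> = 2 powr (real (Suc k) * p)"
    by (simp only: powr_realpow[symmetric] powr_powr zero_less_numeral)
  finally have "ennreal (a powr p) \<le> ennreal (2 powr (real (Suc k) * p)) * indicator {t. t > 2 ^ k} a"
    using lower by (simp add: ennreal_leI)
  also have "\<dots> \<le> (\<Sum>k. ennreal (2 powr (real (Suc k) * p)) * indicator {t. t > 2 ^ k} a)"
  proof -
    have "f k \<le> (\<Sum>k. f k)" for f :: "nat \<Rightarrow> ennreal"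
      using sum_le_suminf[of f "{k}"] by simp
    then show ?thesis .
  qed
  finally show ?thesis by (simp add: add_increasing)
qed

text \<open>Unit normalisation and a hypothesis on increments make \<open>C\<close> depend on
  \<open>p\<close> and the dimension only. The decay rate \<open>s\<close> is taken strictly above
  \<open>p\<close>, so that the layers sum to a geometric series.\<close>

lemma subcritical_embedding_unit:
  assumes p: "p \<ge> 2" and dim: "DIM('a::euclidean_space) \<ge> 2"
    and sub: "p < 2 + 2 * p / DIM('a)"
  obtains C where "C \<ge> 0" "\<And>u :: 'a \<Rightarrow> real. square_integrable u \<Longrightarrow> (\<integral>x. (u x)\<^sup>2 \<partial>lborel) \<le> 1 \<Longrightarrow>
     (\<And>y. (\<integral>x. (u (x + y) - u x)\<^sup>2 \<partial>lborel) \<le> (norm y)\<^sup>2) \<Longrightarrow>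
     (\<integral>\<^sup>+x. ennreal (\<bar>u x\<bar> powr p) \<partial>lborel) \<le> ennreal C"
proof -
  define d where "d = real DIM('a)"
  have d: "d \<ge> 2" using dim by (simp add: d_def)
  \<comment> \<open>The subcritical inequality is strict, so by continuity it persists slightly
    above \<open>p\<close>.\<close>
  have "\<exists>s>p. s < 2 + 2 * s / d"
  proof -
    have "((\<lambda>s. 2 + 2 * s / d - s) \<longlongrightarrow> 2 + 2 * p / d - p) (at_right p)"
      using d by (intro tendsto_intros) auto
    then have "\<forall>\<^sub>F s in at_right p. 0 < 2 + 2 * s / d - s"
      by (rule order_tendstoD) (use sub in \<open>simp add: d_def\<close>)
    then have "\<forall>\<^sub>F s in at_right p. p < s \<and> s < 2 + 2 * s / d"
      using eventually_at_right_less[of p] by eventually_elim simp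
    then show ?thesis using eventually_happens by fastforce
  qed
  then obtain s where s: "s > p" "s < 2 + 2 * s / d" by blast
  with p have "s > 0" by linarith
  \<comment> \<open>This is the constant of the doubling estimate for \<open>G = 1\<close> and
    \<open>\<epsilon> ^ d = 2 * m k\<close>, where
    \<open>\<epsilon>^2 = 2 powr (2 / d) * m k powr (2 / d)\<close>.\<close>
  define C0 where "C0 = 2 * d * 2 powr (2 / d)"
  have C0: "C0 \<ge> 0" using d by (simp add: C0_def)
  obtain B where B: "B \<ge> 0" "\<And>m k. (\<And>k. 0 \<le> m k \<and> m k \<le> 1) \<Longrightarrow>
      (\<And>k. m (Suc k) \<le> C0 * 2 powr (- 2 * real k) * m k powr (2 / d)) \<Longrightarrow> m k \<le> B * 2 powr (- real k * s)"
    using superlevel_sequence_decay[OF C0 d \<open>s > 0\<close> s(2)] by blast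
  \<comment> \<open>From one level to the next the weight grows by \<open>2 powr p\<close> and the
    measure bound shrinks by \<open>2 powr (- s)\<close>.\<close>
  define r where "r = 2 powr (p - s)"
  have r: "0 < r" "r < 1" using s(1) by (simp_all add: r_def powr_less_one)
  have sum_r: "summable (\<lambda>k. 2 powr p * B * r ^ k)"
    using r by (intro summable_mult summable_geometric) auto
  define C where "C = 1 + (\<Sum>k. 2 powr p * B * r ^ k)"
  have S_nonneg: "0 \<le> (\<Sum>k. 2 powr p * B * r ^ k)"
    using r B by (intro suminf_nonneg[OF sum_r]) auto
  show ?thesis
  proof
    show "C \<ge> 0" using S_nonneg by (simp add: C_def)
    fix u :: "'a \<Rightarrow> real"
    assume u: "square_integrable u" and u1: "(\<integral>x. (u x)\<^sup>2 \<partial>lborel) \<le> 1"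
      and trans: "\<And>y. (\<integral>x. (u (x + y) - u x)\<^sup>2 \<partial>lborel) \<le> (norm y)\<^sup>2"
    have [measurable]: "u \<in> borel_measurable borel" using u by (simp add: square_integrable_def)
    define m where "m k = measure lborel {x. \<bar>u x\<bar> > 2 ^ k}" for k :: nat
    have m01: "0 \<le> m k \<and> m k \<le> 1" for k
      using superlevel_measure_le(2)[OF u, of "2 ^ k"] u1 by (simp add: m_def)
    have step: "m (Suc k) \<le> C0 * 2 powr (- 2 * real k) * m k powr (2 / d)" for k
    \<comment> \<open>The cube needs a positive side, so a null level set is treated apart: it
      contains the next one.\<close>
    proof (cases "m k = 0")
      case True
      have "m (Suc k) \<le> m k"
        unfolding m_def
        by (rule measure_mono_fmeasurable) (use superlevel_measure_le(1)[OF u, of "2 ^ k"] in \<open>auto\<close>)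
      with True show ?thesis by simp
    next
      case False
      with m01[of k] have mk: "m k > 0" by simp
      define \<epsilon> where "\<epsilon> = (2 * m k) powr (1 / d)"
      have e: "\<epsilon> > 0" "\<epsilon> ^ DIM('a) = 2 * m k"
        using mk d by (auto simp: \<epsilon>_def powr_realpow[symmetric] powr_powr d_def)
      have "m (Suc k) * (2 ^ k)\<^sup>2 \<le> 2 * d * \<epsilon>\<^sup>2 * 1"
        unfolding m_def d_def power_Suc
        by (rule superlevel_measure_doubling[OF u]) (use e trans in \<open>auto simp: m_def\<close>)
      also have "\<epsilon>\<^sup>2 = 2 powr (2 / d) * m k powr (2 / d)"
        using mk by (simp add: \<epsilon>_def powr_power powr_mult power_mult_distrib)
      also have "(2 ^ k :: real)\<^sup>2 = 2 powr (2 * real k)"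
        using powr_realpow[of 2 "2 * k"] by (simp add: power_mult[symmetric] mult.commute)
      finally have "m (Suc k) * 2 powr (2 * real k) \<le> C0 * m k powr (2 / d)"
        by (simp add: C0_def mult_ac)
      then have "m (Suc k) * 2 powr (2 * real k) * 2 powr (- 2 * real k) \<le> C0 * m k powr (2 / d) * 2 powr (- 2 * real k)"
        by (rule mult_right_mono) simp
      then show ?thesis
        by (simp add: mult.assoc powr_add[symmetric]) (simp add: mult_ac)
    qed
    have m_le: "m k \<le> B * 2 powr (- real k * s)" for k
      by (rule B(2)) (use m01 step in auto)
    have layer_meas: "(\<lambda>x. ennreal (2 powr (real (Suc k) * p)) * indicator {x. \<bar>u x\<bar> > 2 ^ k} x) \<in> borel_measurable borel" for k
      by measurable
    have "(\<integral>\<^sup>+x. ennreal (\<bar>u x\<bar> powr p) \<partial>lborel)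
      \<le> (\<integral>\<^sup>+x. ennreal ((u x)\<^sup>2) + (\<Sum>k. ennreal (2 powr (real (Suc k) * p)) * indicator {x. \<bar>u x\<bar> > 2 ^ k} x) \<partial>lborel)"
      using powr_le_square_plus_layers[OF abs_ge_zero p]
      by (intro nn_integral_mono) (auto simp: indicator_def)
    also have "\<dots> = (\<integral>\<^sup>+x. ennreal ((u x)\<^sup>2) \<partial>lborel)
       + (\<integral>\<^sup>+x. (\<Sum>k. ennreal (2 powr (real (Suc k) * p)) * indicator {x. \<bar>u x\<bar> > 2 ^ k} x) \<partial>lborel)"
      by (rule nn_integral_add) (use layer_meas in \<open>auto intro!: borel_measurable_suminf\<close>)
    also have "(\<integral>\<^sup>+x. (\<Sum>k. ennreal (2 powr (real (Suc k) * p)) * indicator {x. \<bar>u x\<bar> > 2 ^ k} x) \<partial>lborel)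
       = (\<Sum>k. \<integral>\<^sup>+x. ennreal (2 powr (real (Suc k) * p)) * indicator {x. \<bar>u x\<bar> > 2 ^ k} x \<partial>lborel)"
      by (rule nn_integral_suminf) (use layer_meas in auto)
    also have "(\<integral>\<^sup>+x. ennreal ((u x)\<^sup>2) \<partial>lborel) \<le> 1"
      using u1 u by (subst nn_integral_eq_integral) (auto simp: square_integrable_real_iff)
    also have "(\<Sum>k. \<integral>\<^sup>+x. ennreal (2 powr (real (Suc k) * p)) * indicator {x. \<bar>u x\<bar> > 2 ^ k} x \<partial>lborel)
       \<le> (\<Sum>k. ennreal (2 powr p * B * r ^ k))"
    proof (rule suminf_le)
      fix k
      have fm: "{x. \<bar>u x\<bar> > 2 ^ k} \<in> fmeasurable lborel"
        by (rule superlevel_measure_le(1)[OF u]) simp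
      have "(\<integral>\<^sup>+x. ennreal (2 powr (real (Suc k) * p)) * indicator {x. \<bar>u x\<bar> > 2 ^ k} x \<partial>lborel)
         = ennreal (2 powr (real (Suc k) * p)) * ennreal (m k)"
        using fm by (subst nn_integral_cmult_indicator)
          (auto simp: m_def fmeasurable_def emeasure_eq_ennreal_measure)
      also have "\<dots> = ennreal (2 powr (real (Suc k) * p) * m k)"
        by (rule ennreal_mult[symmetric]) (use m01 in auto)
      also have "2 powr (real (Suc k) * p) * m k \<le> 2 powr (real (Suc k) * p) * (B * 2 powr (- real k * s))"
        by (rule mult_left_mono[OF m_le]) simp
      also have "\<dots> = 2 powr p * B * r ^ k"
        by (simp add: r_def powr_realpow[symmetric] powr_powr powr_add[symmetric] algebra_simps)
      finally show "(\<integral>\<^sup>+x. ennreal (2 powr (real (Suc k) * p)) * indicator {x. \<bar>u x\<bar> > 2 ^ k} x \<partial>lborel)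
        \<le> ennreal (2 powr p * B * r ^ k)" by (simp add: ennreal_leI)
    qed auto
    also have "(\<Sum>k. ennreal (2 powr p * B * r ^ k)) = ennreal (\<Sum>k. 2 powr p * B * r ^ k)"
      by (rule suminf_ennreal2[OF _ sum_r]) (use B r in auto)
    finally show "(\<integral>\<^sup>+x. ennreal (\<bar>u x\<bar> powr p) \<partial>lborel) \<le> ennreal C"
      using S_nonneg by (simp add: C_def add_mono ennreal_plus)
  qed
qed

subsection \<open>Subcritical embedding\<close>

lemma H1_weak_gradient:
  assumes "u \<in> H1"
  shows "square_integrable u" "square_integrable (weak_gradient u)" "has_weak_gradient u (weak_gradient u)"
proof -
  have "\<exists>g. square_integrable g \<and> has_weak_gradient u g" using assms by (simp add: H1_def)
  from someI_ex[OF this] show "square_integrable (weak_gradient u)" "has_weak_gradient u (weak_gradient u)"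
    by (auto simp: weak_gradient_def)
qed (use assms in \<open>simp add: H1_def\<close>)

lemma energy_eq:
  assumes "u \<in> H1"
  shows "energy l u = (\<integral>x. (norm (weak_gradient u x))\<^sup>2 \<partial>lborel) + l * (\<integral>x. (u x)\<^sup>2 \<partial>lborel)"
  using H1_weak_gradient[OF assms] by (simp add: energy_def square_integrable_def)

lemma energy_nonneg: "l \<ge> 0 \<Longrightarrow> energy l u \<ge> 0"
  unfolding energy_def by (intro integral_nonneg_AE) auto

text \<open>Division by the square root of \<open>energy 1 u\<close> reduces to the normalised case;
  only the translation estimate has to be carried over to \<open>v\<close>, so no weak gradient of
  \<open>v\<close> is identified. Integrability belongs to the conclusion because a non-integrable
  power would have integral \<open>0\<close> by convention.\<close>

lemma subcritical_embedding:
  assumes p: "p \<ge> 2" and dim: "DIM('a::euclidean_space) \<ge> 2"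
    and sub: "p < 2 + 2 * p / DIM('a)"
  obtains C where "C > 0" "\<And>u :: 'a \<Rightarrow> real. u \<in> H1 \<Longrightarrow>
     integrable lborel (\<lambda>x. \<bar>u x\<bar> powr p) \<and>
     (\<integral>x. \<bar>u x\<bar> powr p \<partial>lborel) \<le> C * energy 1 u powr (p / 2)"
proof -
  obtain C where C: "C \<ge> 0" "\<And>u :: 'a \<Rightarrow> real. square_integrable u \<Longrightarrow> (\<integral>x. (u x)\<^sup>2 \<partial>lborel) \<le> 1 \<Longrightarrow>
     (\<And>y. (\<integral>x. (u (x + y) - u x)\<^sup>2 \<partial>lborel) \<le> (norm y)\<^sup>2) \<Longrightarrow>
     (\<integral>\<^sup>+x. ennreal (\<bar>u x\<bar> powr p) \<partial>lborel) \<le> ennreal C"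
    using subcritical_embedding_unit[OF assms] by blast
  have main: "(\<integral>\<^sup>+x. ennreal (\<bar>u x\<bar> powr p) \<partial>lborel) \<le> ennreal (C * energy 1 u powr (p / 2))"
    if u: "u \<in> H1" for u :: "'a \<Rightarrow> real"
  proof -
    have "square_integrable u" by (rule H1_weak_gradient(1)[OF u])
    have [measurable]: "u \<in> borel_measurable borel"
      using \<open>square_integrable u\<close> by (simp add: square_integrable_def)
    define N where "N = energy 1 u"
    define G where "G = (\<integral>x. (norm (weak_gradient u x))\<^sup>2 \<partial>lborel)"
    have N: "N = G + (\<integral>x. (u x)\<^sup>2 \<partial>lborel)"
      by (simp add: N_def G_def energy_eq[OF u])
    have "G \<ge> 0" "(\<integral>x. (u x)\<^sup>2 \<partial>lborel) \<ge> 0" by (simp_all add: G_def)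
    show ?thesis
    \<comment> \<open>Zero energy forbids the scaling, but forces \<open>u\<close> to vanish almost
      everywhere.\<close>
    proof (cases "N = 0")
      case True
      with N \<open>G \<ge> 0\<close> \<open>(\<integral>x. (u x)\<^sup>2 \<partial>lborel) \<ge> 0\<close> have "(\<integral>x. (u x)\<^sup>2 \<partial>lborel) = 0" by linarith
      then have "AE x in lborel. (u x)\<^sup>2 = 0"
        using \<open>square_integrable u\<close>
        by (subst integral_nonneg_eq_0_iff_AE[symmetric]) (auto simp: square_integrable_real_iff)
      then have "AE x in lborel. ennreal (\<bar>u x\<bar> powr p) = 0"
        by eventually_elim simp
      then show ?thesis by (subst nn_integral_cong_AE) auto
    next
      case False
      with N \<open>G \<ge> 0\<close> \<open>(\<integral>x. (u x)\<^sup>2 \<partial>lborel) \<ge> 0\<close> have Npos: "N > 0" by linarith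
      define v where "v x = (1 / sqrt N) * u x" for x
      have v_sq: "(a * (1 / sqrt N))\<^sup>2 = (1 / N) * a\<^sup>2" for a
        using Npos by (simp add: power_mult_distrib power_divide)
      have nn: "(\<integral>\<^sup>+x. ennreal (\<bar>v x\<bar> powr p) \<partial>lborel) \<le> ennreal C"
      proof (rule C(2))
        show "square_integrable v"
          unfolding v_def by (rule square_integrable_cmult) fact
        have "(\<integral>x. (v x)\<^sup>2 \<partial>lborel) = (1 / N) * (\<integral>x. (u x)\<^sup>2 \<partial>lborel)"
          using v_sq[of "u _"] by (simp add: v_def mult.commute)
        also have "\<dots> \<le> 1" using Npos N \<open>G \<ge> 0\<close> by (simp add: field_simps)
        finally show "(\<integral>x. (v x)\<^sup>2 \<partial>lborel) \<le> 1" .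
        fix y
        have "(v (x + y) - v x)\<^sup>2 = (1 / N) * (u (x + y) - u x)\<^sup>2" for x
          using v_sq[of "u (x + y) - u x"] by (simp add: v_def algebra_simps diff_divide_distrib)
        then have "(\<integral>x. (v (x + y) - v x)\<^sup>2 \<partial>lborel) = (1 / N) * (\<integral>x. (u (x + y) - u x)\<^sup>2 \<partial>lborel)"
          by simp
        also have "\<dots> \<le> (1 / N) * ((norm y)\<^sup>2 * G)"
          unfolding G_def using Npos
            H1_weak_gradient[OF u] by (intro mult_left_mono weak_gradient_translation_bound) auto
        also have "\<dots> \<le> (1 / N) * ((norm y)\<^sup>2 * N)"
          using N \<open>(\<integral>x. (u x)\<^sup>2 \<partial>lborel) \<ge> 0\<close> Npos by (intro mult_left_mono) auto
        finally show "(\<integral>x. (v (x + y) - v x)\<^sup>2 \<partial>lborel) \<le> (norm y)\<^sup>2" using Npos by simp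
      qed
      have "\<bar>u x\<bar> powr p = N powr (p / 2) * \<bar>v x\<bar> powr p" for x
      proof -
        have "\<bar>u x\<bar> = sqrt N * \<bar>v x\<bar>" using Npos by (simp add: v_def abs_mult)
        moreover have "sqrt N powr p = N powr (p / 2)"
          using Npos by (simp add: powr_half_sqrt[symmetric] powr_powr)
        ultimately show ?thesis using Npos by (simp add: powr_mult)
      qed
      then have "(\<integral>\<^sup>+x. ennreal (\<bar>u x\<bar> powr p) \<partial>lborel) = (\<integral>\<^sup>+x. ennreal (N powr (p / 2)) * ennreal (\<bar>v x\<bar> powr p) \<partial>lborel)"
        by (simp add: ennreal_mult)
      also have "\<dots> = ennreal (N powr (p / 2)) * (\<integral>\<^sup>+x. ennreal (\<bar>v x\<bar> powr p) \<partial>lborel)"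
        by (rule nn_integral_cmult) (simp add: v_def)
      also have "\<dots> \<le> ennreal (N powr (p / 2)) * ennreal C"
        by (rule mult_left_mono[OF nn]) simp
      also have "\<dots> = ennreal (C * N powr (p / 2))"
        using C(1) by (simp add: ennreal_mult[symmetric] mult.commute)
      finally show ?thesis by (simp add: N_def)
    qed
  qed
  show ?thesis
  proof
    \<comment> \<open>The constant is raised by \<open>1\<close> to be positive, since it is divided
      by later.\<close>
    show "C + 1 > 0" using C(1) by simp
    fix u :: "'a \<Rightarrow> real" assume u: "u \<in> H1"
    have [measurable]: "u \<in> borel_measurable borel"
      using H1_weak_gradient(1)[OF u] by (simp add: square_integrable_def)
    have "(\<integral>x. \<bar>u x\<bar> powr p \<partial>lborel) \<le> C * energy 1 u powr (p / 2)"
      using main[OF u] C(1) by (intro integral_real_bounded) auto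
    also have "\<dots> \<le> (C + 1) * energy 1 u powr (p / 2)"
      by (intro mult_right_mono) auto
    finally have "(\<integral>x. \<bar>u x\<bar> powr p \<partial>lborel) \<le> (C + 1) * energy 1 u powr (p / 2)" .
    moreover have "(\<integral>\<^sup>+x. ennreal (\<bar>u x\<bar> powr p) \<partial>lborel) < \<infinity>"
      using main[OF u] by (rule le_less_trans) simp
    then have "integrable lborel (\<lambda>x. \<bar>u x\<bar> powr p)"
      by (intro integrableI_nonneg) auto
    ultimately show "integrable lborel (\<lambda>x. \<bar>u x\<bar> powr p) \<and>
      (\<integral>x. \<bar>u x\<bar> powr p \<partial>lborel) \<le> (C + 1) * energy 1 u powr (p / 2)" by blast
  qed
qed

section \<open>Positivity and use of the Sobolev constants\<close>

lemma integral_powr_pos: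
  fixes u :: "'a::euclidean_space \<Rightarrow> real"
  assumes "integrable lborel (\<lambda>x. \<bar>u x\<bar> powr p)" "\<not> (AE x in lborel. u x = 0)"
  shows "(\<integral>x. \<bar>u x\<bar> powr p \<partial>lborel) > 0"
proof -
  have "(\<integral>x. \<bar>u x\<bar> powr p \<partial>lborel) \<noteq> 0"
    using assms by (subst integral_nonneg_eq_0_iff_AE) auto
  moreover have "(\<integral>x. \<bar>u x\<bar> powr p \<partial>lborel) \<ge> 0" by simp
  ultimately show ?thesis by linarith
qed

lemma sobolev_const_pos:
  assumes p: "p \<ge> 2" and dim: "DIM('a::euclidean_space) \<ge> 2"
    and sub: "p < 2 + 2 * p / DIM('a)" and l: "l > 0" and m: "m > 0"
  shows "sobolev_const TYPE('a) p l m > 0"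
proof -
  obtain C where C: "C > 0" "\<And>u :: 'a \<Rightarrow> real. u \<in> H1 \<Longrightarrow>
     integrable lborel (\<lambda>x. \<bar>u x\<bar> powr p) \<and>
     (\<integral>x. \<bar>u x\<bar> powr p \<partial>lborel) \<le> C * energy 1 u powr (p / 2)"
    using subcritical_embedding[OF p dim sub] by blast
  \<comment> \<open>With \<open>E = energy 1 u\<close>, the embedding gives
    \<open>(m * J) powr (2 / p) \<le> (m * C) powr (2 / p) * E\<close>, while
    \<open>energy l u\<close> is at least \<open>min 1 l * E\<close>; \<open>c\<close> is the
    quotient of the two constants.\<close>
  define c where "c = min 1 l / (m * C) powr (2 / p)"
  have "c > 0" using l m C(1) by (simp add: c_def)
  also have "c \<le> sobolev_const TYPE('a) p l m"
    unfolding sobolev_const_def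
  proof (rule cINF_greatest)
    obtain w :: "'a \<Rightarrow> real" where "w \<in> H1" "\<And>x. norm x < 1 \<Longrightarrow> w x > 0"
      using H1_positive_on_ball by blast
    then show "{u :: 'a \<Rightarrow> real. u \<in> H1 \<and> \<not> (AE x in lborel. u x = 0)} \<noteq> {}"
      using not_AE_zero_if_positive_on_ball by blast
    fix u :: "'a \<Rightarrow> real"
    assume "u \<in> {u. u \<in> H1 \<and> \<not> (AE x in lborel. u x = 0)}"
    then have u: "u \<in> H1" "\<not> (AE x in lborel. u x = 0)" by auto
    define J where "J = (\<integral>x. \<bar>u x\<bar> powr p \<partial>lborel)"
    have J: "J > 0" "J \<le> C * energy 1 u powr (p / 2)"
      using C(2)[OF u(1)] integral_powr_pos[OF _ u(2)] by (auto simp: J_def)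
    have E: "min 1 l * energy 1 u \<le> energy l u"
    proof -
      have "min 1 l * (\<integral>x. (norm (weak_gradient u x))\<^sup>2 \<partial>lborel) \<le> 1 * (\<integral>x. (norm (weak_gradient u x))\<^sup>2 \<partial>lborel)"
        "min 1 l * (\<integral>x. (u x)\<^sup>2 \<partial>lborel) \<le> l * (\<integral>x. (u x)\<^sup>2 \<partial>lborel)"
        by (intro mult_right_mono; simp)+
      then show ?thesis by (simp add: energy_eq[OF u(1)] distrib_left)
    qed
    have "(m * J) powr (2 / p) \<le> (m * (C * energy 1 u powr (p / 2))) powr (2 / p)"
      using J m p by (intro powr_mono2) auto
    also have "\<dots> = (m * C) powr (2 / p) * energy 1 u"
      using m C(1) p energy_nonneg[of 1 u] by (simp add: powr_mult powr_powr)
    finally have le: "(m * J) powr (2 / p) \<le> (m * C) powr (2 / p) * energy 1 u" .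
    have "c * (m * J) powr (2 / p) \<le> c * ((m * C) powr (2 / p) * energy 1 u)"
      using \<open>c > 0\<close> by (intro mult_left_mono le) auto
    also have "\<dots> = min 1 l * energy 1 u"
      using m C(1) by (simp add: c_def)
    also note E
    finally have "c * (m * J) powr (2 / p) \<le> energy l u" .
    then have "c \<le> energy l u / (m * J) powr (2 / p)"
      using J m by (subst pos_le_divide_eq) auto
    then show "c \<le> energy l u / (\<integral>x. m * \<bar>u x\<bar> powr p \<partial>lborel) powr (2 / p)"
      by (simp add: J_def)
  qed
  finally show ?thesis .
qed

lemma integral_powr_le_sobolev:
  fixes u :: "'a::euclidean_space \<Rightarrow> real"
  assumes p: "p > 0" and l: "l > 0" and m: "m > 0" and S: "0 < S" "S \<le> sobolev_const TYPE('a) p l m"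
    and u: "u \<in> H1"
  shows "(\<integral>x. m * \<bar>u x\<bar> powr p \<partial>lborel) \<le> S powr (- (p / 2)) * energy l u powr (p / 2)"
proof (cases "AE x in lborel. u x = 0")
  case True
  then have "AE x in lborel. m * \<bar>u x\<bar> powr p = 0" by eventually_elim simp
  then have "(\<integral>x. m * \<bar>u x\<bar> powr p \<partial>lborel) = 0" by (rule integral_eq_zero_AE)
  moreover have "0 \<le> S powr (- (p / 2)) * energy l u powr (p / 2)" by simp
  ultimately show ?thesis by linarith
next
  case False
  define J where "J = (\<integral>x. m * \<bar>u x\<bar> powr p \<partial>lborel)"
  have "J \<ge> 0" using m by (simp add: J_def)
  have "S \<le> energy l u / J powr (2 / p)"
  proof -
    have "sobolev_const TYPE('a) p l m \<le> energy l u / J powr (2 / p)"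
      unfolding sobolev_const_def J_def
      by (rule cINF_lower)
        (use u False l in \<open>auto intro!: bdd_belowI2[of _ 0] divide_nonneg_nonneg energy_nonneg\<close>)
    with S(2) show ?thesis by linarith
  qed
  show ?thesis
  proof (cases "J = 0")
    case True
    moreover have "0 \<le> S powr (- (p / 2)) * energy l u powr (p / 2)" by simp
    ultimately show ?thesis unfolding J_def by linarith
  next
    case False
    with \<open>J \<ge> 0\<close> have "J > 0" by simp
    with \<open>S \<le> energy l u / J powr (2 / p)\<close> have "S * J powr (2 / p) \<le> energy l u"
      by (simp add: field_simps)
    then have "(S * J powr (2 / p)) powr (p / 2) \<le> energy l u powr (p / 2)"
      using S p by (intro powr_mono2) auto
    moreover have "(S * J powr (2 / p)) powr (p / 2) = S powr (p / 2) * J"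
      using S p \<open>J > 0\<close> by (simp add: powr_mult powr_powr)
    ultimately have "J \<le> S powr (- (p / 2)) * energy l u powr (p / 2)"
      using S by (simp add: powr_minus field_simps)
    then show ?thesis by (simp only: J_def)
  qed
qed

subsection \<open>Power-sum and Hoelder inequalities\<close>

text \<open>In \<open>z powr r = z powr (r - 1) * z\<close> the first factor may be enlarged to
  \<open>(x + y) powr (r - 1)\<close>.\<close>

lemma powr_superadditive:
  fixes x y r :: real
  assumes "x \<ge> 0" "y \<ge> 0" "r \<ge> 1"
  shows "x powr r + y powr r \<le> (x + y) powr r"
proof -
  have split: "z powr r = z powr (r - 1) * z" if "z \<ge> 0" for z :: real
    using that powr_add[of z "r - 1" 1] by simp
  have "x powr (r - 1) * x \<le> (x + y) powr (r - 1) * x" "y powr (r - 1) * y \<le> (x + y) powr (r - 1) * y"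
    using assms by (intro mult_right_mono powr_mono2; simp)+
  then show ?thesis
    using assms by (simp add: split distrib_left)
qed

text \<open>The separate summand \<open>x\<close> is meant for the sum of the two largest terms,
  which stays grouped while the others are added.\<close>

lemma sum_powr_superadditive:
  fixes a :: "'i \<Rightarrow> real"
  assumes "finite A" "\<And>i. i \<in> A \<Longrightarrow> a i \<ge> 0" "x \<ge> 0" "r \<ge> 1"
  shows "x powr r + (\<Sum>i\<in>A. a i powr r) \<le> (x + (\<Sum>i\<in>A. a i)) powr r"
  using assms(1,2)
proof (induction A rule: finite_induct)
  case (insert j A)
  have "x powr r + (\<Sum>i\<in>insert j A. a i powr r) \<le> (x + (\<Sum>i\<in>A. a i)) powr r + a j powr r"
    using insert by simp
  also have "\<dots> \<le> ((x + (\<Sum>i\<in>A. a i)) + a j) powr r"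
    using insert assms by (intro powr_superadditive) (auto intro!: add_nonneg_nonneg sum_nonneg)
  finally show ?case using insert by (simp add: add_ac)
qed simp

text \<open>By the mean value theorem, adding \<open>t\<close> to \<open>s\<close> raises the power
  by at least \<open>r\<close> times \<open>s powr (r - 1) * t\<close>; one such unit pays for
  \<open>t powr r\<close>, and \<open>r - 1\<close> remain.\<close>

lemma powr_sum_two_gap:
  fixes s t r :: real
  assumes "0 \<le> t" "t \<le> s" "r \<ge> 1"
  shows "s powr r + t powr r + (r - 1) * (s powr (r - 1) * t) \<le> (s + t) powr r"
proof (cases "t = 0")
  case False
  with assms have pos: "t > 0" "s > 0" by auto
  have "\<exists>z. s < z \<and> z < s + t \<and> (s + t) powr r - s powr r = (s + t - s) * (r * z powr (r - 1))"
    by (rule MVT2) (use pos in \<open>auto intro!: derivative_eq_intros\<close>)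
  then obtain z where z: "s < z" "(s + t) powr r - s powr r = t * (r * z powr (r - 1))" by auto
  have "t * (r * s powr (r - 1)) \<le> t * (r * z powr (r - 1))"
    using z(1) pos assms by (intro mult_left_mono powr_mono2) auto
  moreover have "t powr r = t powr (r - 1) * t"
    using pos powr_add[of t "r - 1" 1] by simp
  moreover have "t powr (r - 1) * t \<le> s powr (r - 1) * t"
    using pos assms by (intro mult_right_mono powr_mono2) auto
  ultimately show ?thesis using z(2) by (simp add: algebra_simps)
qed simp

text \<open>Only the two largest terms matter: with \<open>s\<close> the largest and \<open>t\<close> the second largest
  \<open>a i\<close>, the gap is at least \<open>(r - 1) * s powr (r - 1) * t\<close>. This dominates the product because
  the other \<open>K - 1\<close> factors contribute \<open>t\<close> to the power \<open>(K - 1) * q / 2 \<ge> 1\<close>; for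
  \<open>K = 2\<close> and \<open>q < 2\<close> it would fail.\<close>

lemma powr_sum_gap_ge_prod:
  fixes a :: "'i \<Rightarrow> real"
  assumes I: "finite I" "card I \<ge> 3" and a: "\<And>i. i \<in> I \<Longrightarrow> a i \<ge> 0" and q: "q \<ge> 1"
    and r: "r = real (card I) * q / 2"
  shows "(r - 1) * (\<Prod>i\<in>I. a i powr (q / 2)) \<le> (\<Sum>i\<in>I. a i) powr r - (\<Sum>i\<in>I. a i powr r)"
proof -
  have K: "real (card I) \<ge> 3" using I(2) by simp
  have "3 * 1 \<le> real (card I) * q" using K q by (intro mult_mono) auto
  then have r1: "r \<ge> 1" by (simp add: r)
  have "2 * 1 \<le> real (card I - 1) * q" using K q I(2) by (intro mult_mono) auto
  then have exp1: "r - q / 2 - 1 \<ge> 0" using I(2) by (simp add: r of_nat_diff field_simps)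
  have maximum: "\<exists>j\<in>A. \<forall>i\<in>A. a i \<le> a j" if "finite A" "A \<noteq> {}" for A
  proof -
    have "Max (a ` A) \<in> a ` A" using that by (intro Max_in) auto
    then obtain j where "j \<in> A" "Max (a ` A) = a j" by auto
    then show ?thesis using that Max_ge[of "a ` A"] by (intro bexI[of _ j]) auto
  qed
  have "I \<noteq> {}" using I(2) by auto
  obtain j where j: "j \<in> I" "\<And>i. i \<in> I \<Longrightarrow> a i \<le> a j"
    using maximum[OF I(1) \<open>I \<noteq> {}\<close>] by blast
  have I': "finite (I - {j})" "card (I - {j}) = card I - 1" "I - {j} \<noteq> {}"
  proof -
    show I1: "finite (I - {j})" "card (I - {j}) = card I - 1" using I j(1) by auto
    show "I - {j} \<noteq> {}" using I1(2) I(2) by (intro notI) simp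
  qed
  obtain k where k: "k \<in> I - {j}" "\<And>i. i \<in> I - {j} \<Longrightarrow> a i \<le> a k"
    using maximum[OF I'(1,3)] by blast
  define s t where "s = a j" "t = a k"
  have st: "0 \<le> t" "t \<le> s" using k j a by (auto simp: s_t_def)
  have sum_split: "(\<Sum>i\<in>I. f i) = f j + f k + (\<Sum>i\<in>I - {j} - {k}. f i)" for f :: "'i \<Rightarrow> real"
    using I(1) j(1) k(1) by (simp add: sum.remove[of I j] sum.remove[of "I - {j}" k])
  have prod_split: "(\<Prod>i\<in>I. a i powr (q / 2)) = s powr (q / 2) * (\<Prod>i\<in>I - {j}. a i powr (q / 2))"
    using I(1) j(1) by (simp add: prod.remove[of I j] s_t_def)
  have "(\<Prod>i\<in>I - {j}. a i powr (q / 2)) \<le> (\<Prod>i\<in>I - {j}. t powr (q / 2))"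
    using a k q by (intro prod_mono conjI powr_mono2) (auto simp: s_t_def)
  also have "\<dots> = t powr (r - q / 2)"
  proof (cases "t = 0")
    case True
    then show ?thesis using I' I(2) by simp
  next
    case False
    then have "(t powr (q / 2)) ^ card (I - {j}) = t powr (q / 2 * real (card (I - {j})))"
      by (simp add: powr_power mult.commute)
    also have "q / 2 * real (card (I - {j})) = r - q / 2"
      using I(2) by (simp add: I'(2) r of_nat_diff field_simps)
    finally show ?thesis by simp
  qed
  also have "\<dots> = t powr (r - q / 2 - 1) * t"
    using st powr_add[of t "r - q / 2 - 1" 1] by simp
  \<comment> \<open>All but one power of \<open>t\<close> is traded for \<open>s\<close>, to reach
    the form of the two-term gap.\<close>
  also have "\<dots> \<le> s powr (r - q / 2 - 1) * t"
    using st exp1 by (intro mult_right_mono powr_mono2) auto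
  finally have "(\<Prod>i\<in>I. a i powr (q / 2)) \<le> s powr (q / 2) * (s powr (r - q / 2 - 1) * t)"
    unfolding prod_split by (rule mult_left_mono) simp
  also have "\<dots> = s powr (r - 1) * t"
    by (simp add: mult.assoc[symmetric] powr_add[symmetric])
  finally have "(r - 1) * (\<Prod>i\<in>I. a i powr (q / 2)) \<le> (r - 1) * (s powr (r - 1) * t)"
    using r1 by (intro mult_left_mono) auto
  also have "\<dots> \<le> (s + t) powr r - s powr r - t powr r"
    using powr_sum_two_gap[OF st r1] by linarith
  \<comment> \<open>The remaining \<open>a i\<close> do not shrink the gap: superadditivity is
    applied with \<open>s + t\<close> as one term.\<close>
  also have "\<dots> \<le> (\<Sum>i\<in>I. a i) powr r - (\<Sum>i\<in>I. a i powr r)"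
    using sum_powr_superadditive[of "I - {j} - {k}" a "s + t" r] I(1) a st r1
    by (simp add: sum_split s_t_def)
  finally show ?thesis .
qed

text \<open>The arithmetic-geometric mean inequality is applied pointwise to
  \<open>f i x ^ card I / J i\<close>, each of integral \<open>1\<close>; positivity of
  \<open>J i\<close> permits this normalisation, and the majorant also yields integrability.\<close>

lemma Holder_prod:
  fixes f :: "'i \<Rightarrow> 'a::euclidean_space \<Rightarrow> real"
  assumes I: "finite I" "I \<noteq> {}"
    and f: "\<And>i. i \<in> I \<Longrightarrow> f i \<in> borel_measurable borel" "\<And>i x. i \<in> I \<Longrightarrow> f i x \<ge> 0"
    and int: "\<And>i. i \<in> I \<Longrightarrow> integrable lborel (\<lambda>x. f i x ^ card I)"
    and pos: "\<And>i. i \<in> I \<Longrightarrow> (\<integral>x. f i x ^ card I \<partial>lborel) > 0"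
  shows "integrable lborel (\<lambda>x. \<Prod>i\<in>I. f i x)"
    "(\<integral>x. (\<Prod>i\<in>I. f i x) \<partial>lborel) \<le> root (card I) (\<Prod>i\<in>I. \<integral>x. f i x ^ card I \<partial>lborel)"
proof -
  define J where "J i = (\<integral>x. f i x ^ card I \<partial>lborel)" for i
  define R where "R = root (card I) (\<Prod>i\<in>I. J i)"
  have K: "card I > 0" using I by (simp add: card_gt_0_iff)
  have J: "J i > 0" if "i \<in> I" for i using pos[OF that] by (simp add: J_def)
  have R: "R > 0" using J K by (simp add: R_def prod_pos)
  define h where "h x = R * ((\<Sum>i\<in>I. f i x ^ card I / J i) / card I)" for x
  have le: "(\<Prod>i\<in>I. f i x) \<le> h x" for x
  proof -
    have "root (card I) (\<Prod>i\<in>I. f i x ^ card I / J i) \<le> (\<Sum>i\<in>I. f i x ^ card I / J i) / card I"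
    proof -
      have nonneg: "f i x ^ card I / J i \<ge> 0" if "i \<in> I" for i
        using f(2)[OF that] J[OF that] by simp
      then have "(\<Prod>i\<in>I. f i x ^ card I / J i) \<ge> 0" by (rule prod_nonneg)
      then have "root (card I) (\<Prod>i\<in>I. f i x ^ card I / J i) = (\<Prod>i\<in>I. f i x ^ card I / J i) powr (1 / card I)"
        using K by (cases "(\<Prod>i\<in>I. f i x ^ card I / J i) = 0") (auto simp: root_powr_inverse)
      with arith_geom_mean[OF I nonneg] show ?thesis
        by (simp add: sum_divide_distrib)
    qed
    moreover have "root (card I) (\<Prod>i\<in>I. f i x ^ card I / J i) = (\<Prod>i\<in>I. f i x) / R"
      using K f by (simp add: prod_dividef prod_power_distrib[symmetric] real_root_divide R_def
          real_root_power_cancel prod_nonneg)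
    ultimately show ?thesis using R by (simp add: h_def field_simps)
  qed
  have int_h: "integrable lborel h"
    unfolding h_def using int by (intro integrable_mult_right integrable_divide integrable_sum) auto
  show int_prod: "integrable lborel (\<lambda>x. \<Prod>i\<in>I. f i x)"
  proof (rule Bochner_Integration.integrable_bound[OF int_h])
    show "(\<lambda>x. \<Prod>i\<in>I. f i x) \<in> borel_measurable lborel"
      using f(1) by (intro borel_measurable_prod) auto
    show "AE x in lborel. norm (\<Prod>i\<in>I. f i x) \<le> norm (h x)"
      using le f(2) by (intro AE_I2) (smt (verit) prod_nonneg real_norm_def)
  qed
  have "(\<integral>x. (\<Prod>i\<in>I. f i x) \<partial>lborel) \<le> (\<integral>x. h x \<partial>lborel)"
    by (rule integral_mono[OF int_prod int_h le])
  also have "\<dots> = R * ((\<Sum>i\<in>I. J i / J i) / card I)"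
    unfolding h_def J_def using int by (simp add: Bochner_Integration.integral_sum)
  also have "(\<Sum>i\<in>I. J i / J i) = (\<Sum>i\<in>I. 1)"
    using J by (intro sum.cong) force+
  finally show "(\<integral>x. (\<Prod>i\<in>I. f i x) \<partial>lborel) \<le> root (card I) (\<Prod>i\<in>I. \<integral>x. f i x ^ card I \<partial>lborel)"
    using K by (simp add: R_def J_def)
qed

section \<open>The lower bound for the quotients defining \<open>beta_bar\<close>\<close>

lemma powr_power_pos_exponent:
  fixes z :: real
  assumes "n > 0"
  shows "(z powr u) ^ n = z powr (real n * u)"
  \<comment> \<open>At \<open>z = 0\<close> the left side is \<open>0 ^ n\<close>, which vanishes
    because \<open>n\<close> is positive.\<close>
  using assms by (cases "z = 0") (auto simp: powr_power)

theorem proposition1p3: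
  fixes K :: nat and q :: real and \<Lambda> \<mu> :: "nat \<Rightarrow> real"
  assumes "CARD('d::finite) \<ge> 2"
    and "K \<ge> 3"
    and "\<And>i. i \<in> {1..K} \<Longrightarrow> \<Lambda> i > 0"
    and "\<And>i. i \<in> {1..K} \<Longrightarrow> \<mu> i > 0"
    and "1 \<le> q"
    and "CARD('d) \<ge> 3 \<Longrightarrow>
           q < 2 * real CARD('d) / (real K * (real CARD('d) - 2))"
  shows "beta_bar TYPE(real ^ 'd) K q \<Lambda> \<mu> > 0"
proof -
  have "K > 0" using assms(2) by simp
  define p where "p = real K * q"
  define r where "r = p / 2"
  have "3 * 1 \<le> real K * q" using assms(2,5) by (intro mult_mono) auto
  then have p: "p \<ge> 3" by (simp add: p_def)
  have dim: "DIM(real ^ 'd) = CARD('d)" by simp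
  \<comment> \<open>Equivalent to \<open>p * (d - 2) < 2 * d\<close>: the exponent hypothesis for
    \<open>d \<ge> 3\<close>, and \<open>0 < 4\<close> for \<open>d = 2\<close>.\<close>
  have sub: "p < 2 + 2 * p / DIM(real ^ 'd)"
  proof (cases "CARD('d) \<ge> 3")
    case True
    then have "p * (real CARD('d) - 2) < 2 * real CARD('d)"
      using assms(6) assms(2) by (simp add: p_def field_simps)
    with True show ?thesis by (simp add: field_simps)
  next
    case False
    with assms(1) have "CARD('d) = 2" by simp
    then show ?thesis by (simp add: dim)
  qed
  define S where "S = S_bar TYPE(real ^ 'd) K q \<Lambda> \<mu>"
  have S_le: "S \<le> sobolev_const TYPE(real ^ 'd) p (\<Lambda> i) (\<mu> i)" if "i \<in> {1..K}" for i
    unfolding S_def S_bar_def p_def using that by (intro Min_le) auto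
  have S: "S > 0"
    unfolding S_def S_bar_def p_def[symmetric] using assms p sub dim
    by (subst Min_gr_iff) (auto intro!: sobolev_const_pos)
  \<comment> \<open>\<open>c i\<close> comes from solving
    \<open>\<mu> i * J i \<le> S powr (- r) * a i powr r\<close> for \<open>J i\<close>; the
    geometric mean \<open>R\<close> of these constants is then the constant in
    \<open>D \<le> R * P\<close>.\<close>
  define c where "c i = S powr (- r) / \<mu> i" for i
  define R where "R = root K (\<Prod>i=1..K. c i)"
  have c: "c i > 0" if "i \<in> {1..K}" for i using that S assms(4) by (simp add: c_def)
  have "(\<Prod>i=1..K. c i) > 0" by (rule prod_pos) (rule c)
  then have R: "R > 0" using assms(2) by (simp add: R_def)
  have r: "r > 1" using p by (simp add: r_def)
  \<comment> \<open>The numerator will be at least \<open>S powr (- r) * (r - 1) * P\<close> and the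
    denominator at most \<open>K * R * P\<close>, with the same product \<open>P\<close> of the
    \<open>a i powr (q / 2)\<close>.\<close>
  define b where "b = S powr (- r) * (r - 1) / (real K * R)"
  have "b > 0" using S r R assms(2) by (simp add: b_def)
  also have "b \<le> beta_bar TYPE(real ^ 'd) K q \<Lambda> \<mu>"
    unfolding beta_bar_def
  proof (rule cINF_greatest)
    obtain w :: "real ^ 'd \<Rightarrow> real" where w: "w \<in> H1" "\<And>x. norm x < 1 \<Longrightarrow> w x > 0"
      using H1_positive_on_ball by blast
    have nz: "\<not> (AE x in lborel. (\<Prod>i=1..K. w x) = 0)"
      by (rule not_AE_zero_if_positive_on_ball) (use w in \<open>auto intro: prod_pos\<close>)
    show "{u :: nat \<Rightarrow> real ^ 'd \<Rightarrow> real. (\<forall>i\<in>{1..K}. u i \<in> H1) \<and>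
        \<not> (AE x in lborel. (\<Prod>i=1..K. u i x) = 0)} \<noteq> {}" (is "?U \<noteq> {}")
    proof -
      have "(\<lambda>i. w) \<in> ?U"
        using w(1) nz by (intro CollectI conjI ballI)
      then show ?thesis by (rule ex_in_conv[THEN iffD1, OF exI])
    qed
  next
    fix u :: "nat \<Rightarrow> real ^ 'd \<Rightarrow> real"
    assume "u \<in> {u. (\<forall>i\<in>{1..K}. u i \<in> H1) \<and> \<not> (AE x in lborel. (\<Prod>i=1..K. u i x) = 0)}"
    then have H: "\<And>i. i \<in> {1..K} \<Longrightarrow> u i \<in> H1" and nz: "\<not> (AE x in lborel. (\<Prod>i=1..K. u i x) = 0)"
      by auto
    define a where "a i = energy (\<Lambda> i) (u i)" for i
    define J where "J i = (\<integral>x. \<bar>u i x\<bar> powr p \<partial>lborel)" for i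
    define D where "D = (\<integral>x. (\<Prod>i=1..K. \<bar>u i x\<bar> powr q) \<partial>lborel)"
    define P where "P = (\<Prod>i=1..K. a i powr (q / 2))"
    have a: "a i \<ge> 0" if "i \<in> {1..K}" for i
      using energy_nonneg less_imp_le[OF assms(3)[OF that]] by (auto simp: a_def)
    have meas: "u i \<in> borel_measurable borel" if "i \<in> {1..K}" for i
      using H1_weak_gradient(1)[OF H[OF that]] by (simp add: square_integrable_def)
    have J_int: "integrable lborel (\<lambda>x. \<bar>u i x\<bar> powr p)" if "i \<in> {1..K}" for i
      by (rule subcritical_embedding[OF _ _ sub]) (use p assms(1) H[OF that] in auto)
    have nz_i: "\<not> (AE x in lborel. u i x = 0)" if "i \<in> {1..K}" for i
    proof
      assume "AE x in lborel. u i x = 0"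
      then have "AE x in lborel. (\<Prod>i=1..K. u i x) = 0"
        by eventually_elim (use that in \<open>auto intro!: prod_zero\<close>)
      with nz show False by blast
    qed
    have J_pos: "J i > 0" if "i \<in> {1..K}" for i
      unfolding J_def by (rule integral_powr_pos[OF J_int[OF that] nz_i[OF that]])
    have mu_J: "\<mu> i * J i \<le> S powr (- r) * a i powr r" if "i \<in> {1..K}" for i
      using integral_powr_le_sobolev[OF _ assms(3,4)[OF that] S S_le[OF that] H[OF that]] p that
      by (simp add: J_def a_def r_def)
    have J_le: "J i \<le> c i * a i powr r" if "i \<in> {1..K}" for i
      using mu_J[OF that] assms(4)[OF that] by (simp add: c_def field_simps)
    have pow: "(\<bar>y\<bar> powr q) ^ K = \<bar>y\<bar> powr p" for y
      unfolding p_def by (rule powr_power_pos_exponent[OF \<open>K > 0\<close>])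
    have Holder: "integrable lborel (\<lambda>x. \<Prod>i\<in>{1..K}. \<bar>u i x\<bar> powr q)" "D \<le> root K (\<Prod>i=1..K. J i)"
      using Holder_prod[of "{1..K}" "\<lambda>i x. \<bar>u i x\<bar> powr q"] assms(2) J_int J_pos meas
      by (auto simp: pow D_def J_def)
    have "root K (\<Prod>i=1..K. J i) \<le> root K (\<Prod>i=1..K. c i * a i powr r)"
      using \<open>K > 0\<close> J_le J_pos by (intro real_root_le_mono prod_mono) (auto intro: less_imp_le)
    also have "\<dots> = R * root K (\<Prod>i=1..K. a i powr r)"
      by (simp add: prod.distrib real_root_mult R_def)
    \<comment> \<open>Since \<open>r = K * q / 2\<close>, each factor is a \<open>K\<close>-th power
      and the root disappears.\<close>
    also have "(\<Prod>i=1..K. a i powr r) = P ^ K"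
      using \<open>K > 0\<close> by (simp add: P_def prod_power_distrib powr_power_pos_exponent r_def p_def)
    also have "root K (P ^ K) = P"
      using \<open>K > 0\<close> by (intro real_root_power_cancel) (auto simp: P_def intro: prod_nonneg)
    finally have D_le: "D \<le> R * P" using Holder(2) by linarith
    \<comment> \<open>A quotient by \<open>0\<close> would be \<open>0\<close> and violate the lower
      bound; the condition on the product of the \<open>u i\<close> excludes this.\<close>
    have "D \<noteq> 0"
    proof
      assume "D = 0"
      then have "AE x in lborel. (\<Prod>i\<in>{1..K}. \<bar>u i x\<bar> powr q) = 0"
        using integral_nonneg_eq_0_iff_AE[OF Holder(1)] by (simp add: D_def prod_nonneg)
      then have "AE x in lborel. (\<Prod>i=1..K. u i x) = 0"
        by eventually_elim auto
      with nz show False by blast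
    qed
    moreover have "D \<ge> 0" unfolding D_def by (simp add: prod_nonneg)
    ultimately have D: "D > 0" by simp
    have "(\<Sum>i=1..K. \<mu> i * J i) \<le> (\<Sum>i=1..K. S powr (- r) * a i powr r)"
      by (rule sum_mono) (rule mu_J)
    then have "S powr (- r) * ((\<Sum>i=1..K. a i) powr r - (\<Sum>i=1..K. a i powr r))
        \<le> S powr (- r) * (\<Sum>i=1..K. a i) powr r - (\<Sum>i=1..K. \<mu> i * J i)"
      by (simp add: sum_distrib_left right_diff_distrib)
    moreover have "(r - 1) * P \<le> (\<Sum>i=1..K. a i) powr r - (\<Sum>i=1..K. a i powr r)"
      unfolding P_def by (rule powr_sum_gap_ge_prod) (use assms a in \<open>auto simp: r_def p_def\<close>)
    then have "S powr (- r) * ((r - 1) * P) \<le> S powr (- r) * ((\<Sum>i=1..K. a i) powr r - (\<Sum>i=1..K. a i powr r))"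
      by (rule mult_left_mono) simp
    ultimately have num: "S powr (- r) * ((r - 1) * P) \<le> S powr (- r) * (\<Sum>i=1..K. a i) powr r - (\<Sum>i=1..K. \<mu> i * J i)"
      by linarith
    have "b * (real K * D) \<le> b * (real K * (R * P))"
      using \<open>b > 0\<close> D_le by (intro mult_left_mono) auto
    also have "\<dots> = S powr (- r) * ((r - 1) * P)"
      using R assms(2) by (simp add: b_def)
    also note num
    finally have "b \<le> (S powr (- r) * (\<Sum>i=1..K. a i) powr r - (\<Sum>i=1..K. \<mu> i * J i)) / (real K * D)"
      using D assms(2) by (subst pos_le_divide_eq) auto
    then show "b \<le> (S_bar TYPE(real ^ 'd) K q \<Lambda> \<mu> powr (- (real K * q / 2)) *
           (\<Sum>i=1..K. energy (\<Lambda> i) (u i)) powr (real K * q / 2)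
         - (\<Sum>i=1..K. \<integral>x. \<mu> i * \<bar>u i x\<bar> powr (real K * q) \<partial>lborel))
        / (real K * (\<integral>x. (\<Prod>i=1..K. \<bar>u i x\<bar> powr q) \<partial>lborel))"
      by (simp add: S_def r_def p_def a_def J_def D_def)
  qed
  finally show ?thesis .
qed

end
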